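(* Let $\mathcal D$ be a distribution on $\mathbb{R}^d$, let $x^*\in\mathbb{S}^{d-1}$, let $\ell(u_1,u_2;x,x^* )$ be a loss, $\ell:\mathbb{R}\times\mathbb{R}\times\mathbb{R}^d\times\mathbb{R}^d\to\mathbb{R}$, locally Lipschitz in $u_1$, and let $g_\ell(x,x^* )=\mathbb{E}_{z\sim\mathcal D}[\partial_1\ell(x\cdot z,x^*\cdot z;x,x^* )\,(I-xx^\top)z]$. Let $x\in\mathbb{S}^{d-1}$ with $\theta=\theta(x,x^* )\in(0,\pi/2)$ and put $v=x^*_{\perp x}/\|x^*_{\perp x}\|_2$, where $x^*_{\perp x}=(I-xx^\top)x^*$. Let $$c_{v\cdot z|x\cdot z}(t)=\mathbb{E}_{z\sim\mathcal D}\big[(v\cdot z-\mathbb{E}[v\cdot z\mid x\cdot z])\,\mathbf 1\{t\le v\cdot z\}\,\big|\,x\cdot z\big].$$ Suppose there are constants $\mu^{(1)},\mu^{(2)}\ge0$ with $\mu^{(1)}+\mu^{(2)}>0$ such that: (a) $\mathbb{E}_{z\sim\mathcal D}\big[\mathbb{E}[\partial_1\ell(x\cdot z,x^*\cdot z;x,x^* )\mid x\cdot z]\;\mathbb{E}[v\cdot z\mid x\cdot z]\big]\le-\mu^{(1)}$; (b) $\partial_1\ell(u_1,u_2;x,x^* )$ is locally Lipschitz in $u_2$, $\ \mathbb{E}_{x\cdot z}\big[\int_{\mathbb{R}}|\partial_2\partial_1\ell(x\cdot z,\,x\cdot z\cos\theta+t\sin\theta;x,x^* )\,c_{v\cdot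 z|x\cdot z}(t)|\,dt\big]<\infty$, and $$\mathbb{E}_{x\cdot z}\Big[\int_{\mathbb{R}}\partial_2\partial_1\ell(x\cdot z,\,x\cdot z\cos\theta+t\sin\theta;x,x^* )\,c_{v\cdot z|x\cdot z}(t)\,dt\Big]\le-\mu^{(2)}.$$ Then: 1. If there is $L_1>0$ with $\|g_\ell(y,x^* )\|_2\le L_1$ for all $y\in\mathbb{S}^{d-1}$, then $\displaystyle g_\ell(x,x^* )\cdot x^*\le-\frac{\mu^{(1)}+\mu^{(2)}\sin\theta}{L_1}\,\sin\theta\,\|g_\ell(x,x^* )\|_2.$ 2. If there is $L_2>0$ with $\|g_\ell(y,x^* )\|_2\le L_2\|y-x^*\|_2$ for all $y\in\mathbb{S}^{d-1}$, then $\displaystyle g_\ell(x,x^* )\cdot x^*\le-\frac{\mu^{(1)}+\mu^{(2)}\sin\theta}{2L_2}\,\|g_\ell(x,x^* )\|_2.$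
   Context: $\mathbb{S}^{d-1}$ is the unit sphere of $\mathbb{R}^d$ and $\theta(x,y)=\arccos(x\cdot y)$ for unit vectors. $\partial_1\ell$ denotes the derivative of $\ell$ in its first argument; where $\ell$ is not differentiable, $\partial_1\ell(u_1,u_2;x,x^* )$ denotes one fixed measurable, integrable single-valued selection from the Clarke subdifferential of $\ell$ in $u_1$ (convex hull of limits of derivatives at nearby differentiability points). $\partial_2\partial_1\ell$ is the derivative of this selection in the second argument (it exists for almost every value of the second argument when $\partial_1\ell$ is locally Lipschitz in it). All displayed expectations and conditional expectations are assumed to exist as finite expectations. $\mathbb{E}_{x\cdot z}$ is expectation over the law of $x\cdot z$, $z\sim\mathcal D$. *)

theory Defs
  imports "HOL-Probability.Probability"
begin

definition theta :: "real ^ 'd \<Rightarrow> real ^ 'd \<Rightarrow> real" where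
  "theta x y = arccos (x \<bullet> y)"

text \<open>\<open>perp x z\<close> is \<open>(I - x x\<^sup>T) z\<close>.\<close>

definition perp :: "real ^ 'd \<Rightarrow> real ^ 'd \<Rightarrow> real ^ 'd" where
  "perp x z = z - (x \<bullet> z) *\<^sub>R x"

text \<open>Unlike \<^const>\<open>local_lipschitz\<close>, this concerns a single function, without a time parameter.\<close>

definition locally_lipschitz :: "(real \<Rightarrow> real) \<Rightarrow> bool" where
  "locally_lipschitz f \<longleftrightarrow> (\<forall>u. \<exists>e>0. \<exists>L. L-lipschitz_on (ball u e) f)"

definition clarke_subdifferential :: "(real \<Rightarrow> real) \<Rightarrow> real \<Rightarrow> real set" where
  "clarke_subdifferential f u =
     convex hull {s. \<exists>w. (\<forall>n. f differentiable at (w n)) \<and> w \<longlonglongrightarrow> u \<and>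
                         (\<lambda>n. deriv f (w n)) \<longlonglongrightarrow> s}"

text \<open>
  \<open>dl\<close> is a single-valued choice of the first partial derivative of the loss: the derivative
  wherever it exists, and an element of the Clarke subdifferential elsewhere. Measurability is
  required in the two real arguments, for each fixed pair of vectors.
\<close>

definition partial1_selection ::
  "(real \<Rightarrow> real \<Rightarrow> real ^ 'd \<Rightarrow> real ^ 'd \<Rightarrow> real) \<Rightarrow>
   (real \<Rightarrow> real \<Rightarrow> real ^ 'd \<Rightarrow> real ^ 'd \<Rightarrow> real) \<Rightarrow> bool" where
  "partial1_selection l dl \<longleftrightarrow>
     (\<forall>u1 u2 y ys.
        (if (\<lambda>u. l u u2 y ys) differentiable at u1
         then dl u1 u2 y ys = deriv (\<lambda>u. l u u2 y ys) u1
         else dl u1 u2 y ys \<in> clarke_subdifferential (\<lambda>u. l u u2 y ys) u1)) \<and>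
     (\<forall>y ys. (\<lambda>(u1, u2). dl u1 u2 y ys) \<in> borel_measurable (borel \<Otimes>\<^sub>M borel))"

text \<open>
  Where \<open>dl\<close> is not differentiable in its second argument, \<^const>\<open>deriv\<close> takes a fixed but
  unspecified value; if \<open>dl\<close> is locally Lipschitz there, this happens only on a null set.
\<close>

definition partial2 ::
  "(real \<Rightarrow> real \<Rightarrow> real ^ 'd \<Rightarrow> real ^ 'd \<Rightarrow> real) \<Rightarrow>
   real \<Rightarrow> real \<Rightarrow> real ^ 'd \<Rightarrow> real ^ 'd \<Rightarrow> real" where
  "partial2 dl u1 u2 y ys = deriv (\<lambda>u. dl u1 u y ys) u2"

definition grad_integrand ::
  "(real \<Rightarrow> real \<Rightarrow> real ^ 'd \<Rightarrow> real ^ 'd \<Rightarrow> real) \<Rightarrow>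
   real ^ 'd \<Rightarrow> real ^ 'd \<Rightarrow> real ^ 'd \<Rightarrow> real ^ 'd" where
  "grad_integrand dl y ys z = dl (y \<bullet> z) (ys \<bullet> z) y ys *\<^sub>R perp y z"

definition g_loss ::
  "(real ^ 'd) measure \<Rightarrow> (real \<Rightarrow> real \<Rightarrow> real ^ 'd \<Rightarrow> real ^ 'd \<Rightarrow> real) \<Rightarrow>
   real ^ 'd \<Rightarrow> real ^ 'd \<Rightarrow> real ^ 'd" where
  "g_loss D dl y ys = (\<integral>z. grad_integrand dl y ys z \<partial>D)"

definition cond_exp_proj ::
  "(real ^ 'd) measure \<Rightarrow> real ^ 'd \<Rightarrow> (real ^ 'd \<Rightarrow> real) \<Rightarrow> real ^ 'd \<Rightarrow> real" where
  "cond_exp_proj D x f =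
     real_cond_exp D (vimage_algebra (space D) (\<lambda>z. x \<bullet> z) borel) f"

abbreviation law_proj :: "(real ^ 'd) measure \<Rightarrow> real ^ 'd \<Rightarrow> real measure" where
  "law_proj D x \<equiv> distr D borel (\<lambda>z. x \<bullet> z)"

text \<open>
  \<open>c s t\<close> is the conditional expectation of \<open>(v \<bullet> z - E[v \<bullet> z | x \<bullet> z]) 1{t \<le> v \<bullet> z}\<close> given
  \<open>x \<bullet> z = s\<close>. For each single \<open>t\<close> this determines \<open>c\<close> only up to a null set depending on
  \<open>t\<close>; in order to integrate over \<open>t\<close> for fixed \<open>s\<close> one has to use a version that is jointly
  measurable (as given by a regular conditional distribution). Two such versions agree for
  almost every pair \<open>(s, t)\<close>, by Fubini, so the integrals do not depend on the choice.
\<close>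

definition is_cond_c ::
  "(real ^ 'd) measure \<Rightarrow> real ^ 'd \<Rightarrow> real ^ 'd \<Rightarrow> (real \<Rightarrow> real \<Rightarrow> real) \<Rightarrow> bool" where
  "is_cond_c D x v c \<longleftrightarrow>
     (\<lambda>(s, t). c s t) \<in> borel_measurable (borel \<Otimes>\<^sub>M borel) \<and>
     (\<forall>t. AE z in D. c (x \<bullet> z) t =
        cond_exp_proj D x
          (\<lambda>w. (v \<bullet> w - cond_exp_proj D x (\<lambda>w'. v \<bullet> w') w) * of_bool (t \<le> v \<bullet> w)) z)"

end

theory Submission
  imports Defs
begin

text \<open>
  Write \<open>S = x \<bullet> z\<close>, \<open>V = v \<bullet> z\<close>, \<open>m = E[V | S]\<close> and
  \<open>\<phi>\<^sub>s(t) = \<partial>\<^sub>1l(s, s cos \<theta> + t sin \<theta>)\<close>. Since \<open>xs = cos \<theta> x + sin \<theta> v\<close>, the integrand of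
  \<open>g(x) \<bullet> xs\<close> is \<open>sin \<theta> \<phi>\<^sub>S(V) V\<close>, and everything reduces to the covariance identity
  (\<open>integral_phi_V\<close>)

  \<open>E[\<phi>\<^sub>S(V) V] = E[E[\<phi>\<^sub>S(V) | S] m] + E[\<integral> \<phi>\<^sub>S'(t) c(S, t) dt]\<close>.

  By (a) and (b) its right-hand side is at most \<open>-(\<mu>1 + \<mu>2 sin \<theta>)\<close>, because
  \<open>\<phi>\<^sub>s' = sin \<theta> \<partial>\<^sub>2\<partial>\<^sub>1l\<close>. The two claims then follow from the bounds on \<open>norm (g(x))\<close>, in the
  second case together with \<open>norm (x - xs) \<le> 2 sin \<theta>\<close>.

  The covariance identity rests on the nonnegative kernel
  \<open>K(t) = (V - m) (1{t \<le> V} - 1{t \<le> m})\<close>. The fundamental theorem of calculus gives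
  \<open>\<integral> \<phi>\<^sub>S'(t) K(t) dt = (V - m) (\<phi>\<^sub>S(V) - \<phi>\<^sub>S(m))\<close>, and \<open>E[K(t) | S] = c(S, t)\<close> because the term with
  \<open>1{t \<le> m}\<close> has conditional mean zero. As \<open>K\<close> is nonnegative, the finiteness hypothesis in (b) is
  exactly absolute integrability of \<open>\<phi>\<^sub>S' K\<close>, so that Fubini applies. It remains to remove \<open>m\<close> and
  \<open>\<phi>\<^sub>S(m)\<close>: \<open>E[(V - m) \<phi>\<^sub>S(m)] = 0\<close> and \<open>E[\<phi>\<^sub>S(V) m] = E[E[\<phi>\<^sub>S(V) | S] m]\<close> hold after restriction to
  the events \<open>|m| \<le> n\<close>, \<open>|\<phi>\<^sub>S(m)| \<le> n\<close>, and dominated convergence removes the restriction. This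
  detour is needed because \<open>\<phi>\<^sub>S(V) m\<close> itself need not be integrable.

  The real analysis behind this is that a locally Lipschitz function on the line is differentiable
  almost everywhere and is the integral of its derivative
  (\<open>AE_differentiable_locally_lipschitz\<close>, \<open>locally_lipschitz_FTC\<close>). Differentiability is
  obtained from the Vitali covering theorem: for a monotone \<open>F\<close> and \<open>p < q\<close>, the points that lie in
  arbitrarily short intervals of slope above \<open>q\<close> and in arbitrarily short intervals of slope below
  \<open>p\<close> form a null set (\<open>steep_flat_null\<close>). Joint measurability of the derivative
  (\<open>measurable_deriv_param\<close>) comes from testing difference quotients at rational increments.
\<close>

section \<open>Slopes of monotone functions\<close>

text \<open>
  Vitali's theorem, with the additional requirement that the selected balls stay inside a given open
  set.
\<close>

lemma Vitali_balls_in_open: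
  fixes S W :: "real set"
  assumes "open W" "S \<subseteq> W"
    and fine: "\<And>x d. x \<in> S \<Longrightarrow> d > 0 \<Longrightarrow> \<exists>c r. 0 < r \<and> r < d \<and> x \<in> ball c r \<and> P c r"
  obtains C where "countable C" "disjoint_family_on (\<lambda>i. ball (fst i) (snd i)) C"
    "\<And>c r. (c, r) \<in> C \<Longrightarrow> 0 < r \<and> P c r"
    "(\<Union>i\<in>C. ball (fst i) (snd i)) \<subseteq> W" "negligible (S - (\<Union>i\<in>C. ball (fst i) (snd i)))"
proof -
  define K where "K = {i. 0 < snd i \<and> P (fst i) (snd i) \<and> ball (fst i) (snd i) \<subseteq> W}"
  have "\<exists>i. i \<in> K \<and> x \<in> ball (fst i) (snd i) \<and> snd i < d" if xS: "x \<in> S" and d: "d > 0" for x d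
  proof -
    obtain e where e: "e > 0" "ball x e \<subseteq> W"
      using assms(1,2) xS by (meson openE subsetD)
    obtain c r where cr: "0 < r" "r < min d (e/2)" "x \<in> ball c r" "P c r"
      using fine[OF xS, of "min d (e/2)"] d e(1) by auto
    have "ball c r \<subseteq> ball x e"
    proof
      fix y assume "y \<in> ball c r"
      then have "dist x y < 2 * r"
        using cr(3) dist_triangle2[of x y c] by (simp add: dist_commute)
      then show "y \<in> ball x e" using cr(2) by simp
    qed
    then have "(c, r) \<in> K" using cr e by (auto simp: K_def)
    then show ?thesis using cr by (intro exI[of _ "(c, r)"]) auto
  qed
  then obtain C where C: "countable C" "C \<subseteq> K"
     "pairwise (\<lambda>i j. disjnt (ball (fst i) (snd i)) (ball (fst j) (snd j))) C"
     "negligible(S - (\<Union>i \<in> C. ball (fst i) (snd i)))"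
    by (rule Vitali_covering_theorem_balls[of S K fst snd])
  show thesis
  proof (rule that[OF C(1) _ _ _ C(4)])
    show "disjoint_family_on (\<lambda>i. ball (fst i) (snd i)) C"
      using C(3) by (auto simp: pairwise_def disjnt_def disjoint_family_on_def)
  qed (use C(2) in \<open>auto simp: K_def\<close>)
qed

lemma emeasure_interval_measure_ball:
  fixes F :: "real \<Rightarrow> real"
  assumes mono: "mono F" and cont: "continuous_on UNIV F" and "r > 0"
  shows "emeasure (interval_measure F) (ball c r) = ennreal (F (c + r) - F (c - r))"
proof -
  have Ioc: "emeasure (interval_measure F) {a<..b} = ennreal (F b - F a)" if "a \<le> b" for a b
    by (rule emeasure_interval_measure_Ioc[OF that])
      (use mono cont in \<open>auto simp: mono_def continuous_on_eq_continuous_within intro: continuous_within_subset\<close>)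
  have eq: "ball c r = (\<Union>n. {c - r<..c + r - r / Suc n})"
  proof safe
    fix x assume "x \<in> ball c r"
    then have x: "c - r < x" "x < c + r" by (auto simp: dist_real_def abs_real_def split: if_splits)
    obtain n where "r / (c + r - x) < real n" using reals_Archimedean2 by blast
    then have "r / (c + r - x) \<le> Suc n" by simp
    then have "r \<le> Suc n * (c + r - x)" using x by (simp add: field_simps)
    then have "r / Suc n \<le> c + r - x" by (simp add: pos_divide_le_eq mult.commute)
    then show "x \<in> (\<Union>n. {c - r<..c + r - r / Suc n})"
      using x by (intro UN_I[of n]) auto
  next
    fix x n assume "x \<in> {c - r<..c + r - r / real (Suc n)}"
    moreover have "r / Suc n > 0" using \<open>r > 0\<close> by simp
    ultimately show "x \<in> ball c r" by (auto simp: dist_real_def abs_real_def)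
  qed
  have "(\<lambda>n. emeasure (interval_measure F) {c - r<..c + r - r / Suc n}) \<longlonglongrightarrow>
          emeasure (interval_measure F) (\<Union>n. {c - r<..c + r - r / Suc n})"
  proof (rule Lim_emeasure_incseq)
    show "incseq (\<lambda>n. {c - r<..c + r - r / Suc n})"
    proof (rule incseq_SucI)
      fix n :: nat
      have "r / Suc (Suc n) \<le> r / Suc n"
        using \<open>r > 0\<close> by (intro divide_left_mono) auto
      then show "{c - r<..c + r - r / Suc n} \<le> {c - r<..c + r - r / Suc (Suc n)}"
        by auto
    qed
  qed auto
  moreover have "emeasure (interval_measure F) {c - r<..c + r - r / Suc n}
      = ennreal (F (c + r - r / Suc n) - F (c - r))" for n
    by (rule Ioc) (use \<open>r > 0\<close> in \<open>simp add: field_simps\<close>)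
  ultimately have lim: "(\<lambda>n. ennreal (F (c + r - r / Suc n) - F (c - r))) \<longlonglongrightarrow>
      emeasure (interval_measure F) (ball c r)"
    by (simp only: eq)
  have "(\<lambda>n. c + r - r / Suc n) \<longlonglongrightarrow> c + r - 0"
    by (rule tendsto_diff[OF tendsto_const LIMSEQ_Suc[OF lim_const_over_n]])
  then have "(\<lambda>n. F (c + r - r / Suc n)) \<longlonglongrightarrow> F (c + r - 0)"
    by (rule continuous_on_tendsto_compose[OF cont]) auto
  then have "(\<lambda>n. ennreal (F (c + r - r / Suc n) - F (c - r))) \<longlonglongrightarrow> ennreal (F (c + r - 0) - F (c - r))"
    by (rule tendsto_ennrealI[OF tendsto_diff[OF _ tendsto_const]])
  then show ?thesis
    using LIMSEQ_unique[OF lim] by simp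
qed

text \<open>
  The points that lie in arbitrarily short open intervals \<open>ball c r\<close> over which \<open>F\<close> has slope greater
  than \<open>q\<close>. The intervals need not be centred at the point, and so each stage of the intersection
  is open and the set is Borel. Small slopes of \<open>F\<close> are large slopes of \<open>-F\<close>: the points with
  arbitrarily short intervals of slope less than \<open>p\<close> are \<open>steep (\<lambda>t. - F t) (- p)\<close>.
\<close>

definition steep :: "(real \<Rightarrow> real) \<Rightarrow> real \<Rightarrow> real set" where
  "steep F q = (\<Inter>n::nat. \<Union>(c, r)\<in>{(c, r). 0 < r \<and> r < 1 / Suc n \<and> q * (2 * r) < F (c + r) - F (c - r)}. ball c r)"

lemma steep_borel [measurable]: "steep F q \<in> sets borel"
  unfolding steep_def by (intro sets.countable_INT'' borel_open) (auto intro!: open_UN)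

lemma steepD:
  assumes "x \<in> steep F q" "d > 0"
  shows "\<exists>c r. 0 < r \<and> r < d \<and> x \<in> ball c r \<and> q * (2 * r) < F (c + r) - F (c - r)"
proof -
  obtain n where n: "1 / Suc n < d" using assms(2) nat_approx_posE by blast
  have "x \<in> (\<Union>(c, r)\<in>{(c, r). 0 < r \<and> r < 1 / Suc n \<and> q * (2 * r) < F (c + r) - F (c - r)}. ball c r)"
    using assms(1) unfolding steep_def by blast
  then show ?thesis using n by force
qed

lemma emeasure_countable_UN_balls:
  assumes "countable C" "disjoint_family_on (\<lambda>i. ball (fst i) (snd i)) C" "sets M = sets (borel :: real measure)"
  shows "emeasure M (\<Union>i\<in>C. ball (fst i) (snd i)) = (\<integral>\<^sup>+i. emeasure M (ball (fst i) (snd i)) \<partial>count_space C)"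
  by (rule emeasure_UN_countable) (use assms in auto)

lemma emeasure_le_of_negligible_diff:
  fixes S T :: "real set"
  assumes "negligible (S - T)" "S \<in> sets borel" "T \<in> sets borel"
  shows "emeasure lborel S = emeasure lborel (S \<inter> T)"
proof -
  have "S - T \<in> null_sets lborel"
    using assms by (simp add: negligible_iff_null_sets null_sets_completion_iff)
  then have "emeasure lborel (S - (S - T)) = emeasure lborel S"
    using assms by (intro emeasure_Diff_null_set) auto
  then show ?thesis by (simp add: Diff_Diff_Int)
qed

text \<open>
  The Stieltjes measure of \<open>F\<close> dominates \<open>q\<close> times Lebesgue measure on the points of slope
  above \<open>q\<close>.
\<close>

lemma steep_mass:
  fixes F :: "real \<Rightarrow> real"
  assumes mono: "mono F" and cont: "continuous_on UNIV F" and "q \<ge> 0"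
    and S: "S \<subseteq> steep F q" "S \<subseteq> W" "S \<in> sets borel" and "open W"
  shows "ennreal q * emeasure lborel S \<le> emeasure (interval_measure F) W"
proof -
  obtain C where C: "countable C" "disjoint_family_on (\<lambda>i. ball (fst i) (snd i)) C"
    "\<And>c r. (c, r) \<in> C \<Longrightarrow> 0 < r \<and> q * (2 * r) < F (c + r) - F (c - r)"
    "(\<Union>i\<in>C. ball (fst i) (snd i)) \<subseteq> W" "negligible (S - (\<Union>i\<in>C. ball (fst i) (snd i)))"
    by (rule Vitali_balls_in_open[OF \<open>open W\<close> S(2), of "\<lambda>c r. q * (2 * r) < F (c + r) - F (c - r)"])
       (use S(1) steepD in blast)+
  let ?B = "\<lambda>i. ball (fst i) (snd i :: real)"
  have ms: "sets (interval_measure F) = sets borel" by simp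
  have "open (\<Union>i\<in>C. ?B i)" by auto
  then have B: "(\<Union>i\<in>C. ?B i) \<in> sets borel" by (rule borel_open)
  have "ennreal q * emeasure lborel S \<le> ennreal q * emeasure lborel (\<Union>i\<in>C. ?B i)"
    using emeasure_le_of_negligible_diff[OF C(5) S(3) B] B
    by (auto intro!: mult_left_mono emeasure_mono)
  also have "\<dots> = (\<integral>\<^sup>+i. ennreal q * emeasure lborel (?B i) \<partial>count_space C)"
    by (simp add: emeasure_countable_UN_balls[OF C(1,2)] nn_integral_cmult)
  also have "\<dots> \<le> (\<integral>\<^sup>+i. emeasure (interval_measure F) (?B i) \<partial>count_space C)"
  proof (rule nn_integral_mono)
    fix i assume "i \<in> space (count_space C)"
    then have i: "0 < snd i" "q * (2 * snd i) < F (fst i + snd i) - F (fst i - snd i)"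
      using C(3)[of "fst i" "snd i"] by auto
    have "emeasure lborel (?B i) = ennreal (2 * snd i)"
      using i by (simp add: ball_eq_greaterThanLessThan)
    then have "ennreal q * emeasure lborel (?B i) = ennreal (q * (2 * snd i))"
      using i \<open>q \<ge> 0\<close> by (simp add: ennreal_mult)
    also have "\<dots> \<le> emeasure (interval_measure F) (?B i)"
      using i by (simp add: emeasure_interval_measure_ball[OF mono cont] ennreal_leI)
    finally show "ennreal q * emeasure lborel (?B i) \<le> emeasure (interval_measure F) (?B i)" .
  qed
  also have "\<dots> = emeasure (interval_measure F) (\<Union>i\<in>C. ?B i)"
    by (rule emeasure_countable_UN_balls[OF C(1,2) ms, symmetric])
  also have "\<dots> \<le> emeasure (interval_measure F) W"
    using C(4) \<open>open W\<close> by (intro emeasure_mono) auto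
  finally show ?thesis .
qed

text \<open>
  Cover the exceptional set \<open>E\<close>, up to a null set, by disjoint intervals of slope below \<open>p\<close> inside an
  open set of measure at most \<open>|E| + e\<close>, and let \<open>W\<close> be their union. Then
  \<open>q |E| = q |E \<inter> W| \<le> \<mu>\<^sub>F(W) \<le> p |W| \<le> p (|E| + e)\<close>, where \<open>\<mu>\<^sub>F\<close> is the Stieltjes measure of \<open>F\<close>,
  which forces \<open>|E| = 0\<close>.
\<close>

lemma steep_flat_null:
  fixes F :: "real \<Rightarrow> real"
  assumes mono: "mono F" and cont: "continuous_on UNIV F" and "p < q"
  shows "steep F q \<inter> steep (\<lambda>t. - F t) (- p) \<in> null_sets lborel"
proof (cases "p > 0")
  case False
  have "steep (\<lambda>t. - F t) (- p) = {}"
  proof safe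
    fix x assume "x \<in> steep (\<lambda>t. - F t) (- p)"
    then obtain c r where "0 < r" and *: "- p * (2 * r) < - F (c + r) - - F (c - r)"
      using steepD[OF _ zero_less_one] by blast
    moreover have "F (c - r) \<le> F (c + r)" using mono \<open>0 < r\<close> by (auto simp: mono_def)
    moreover have "p * (2 * r) \<le> 0" using False \<open>0 < r\<close> by (simp add: mult_nonpos_nonneg)
    ultimately show "x \<in> {}" by simp
  qed
  then show ?thesis by simp
next
  case True
  let ?B = "\<lambda>i. ball (fst i) (snd i :: real)"
  \<comment> \<open>Restriction to bounded sets makes the measure finite, so that it can be cancelled.\<close>
  have "ball 0 (real N) \<inter> (steep F q \<inter> steep (\<lambda>t. - F t) (- p)) \<in> null_sets lborel" for N :: nat
  proof -
    define E where "E = ball 0 (real N) \<inter> (steep F q \<inter> steep (\<lambda>t. - F t) (- p))"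
    have E_sub: "E \<subseteq> steep F q" "E \<subseteq> steep (\<lambda>t. - F t) (- p)" unfolding E_def by auto
    have E[measurable]: "E \<in> sets borel" unfolding E_def by simp
    have "emeasure lborel E \<le> emeasure lborel (ball (0::real) (real N))"
      unfolding E_def by (intro emeasure_mono) auto
    then have fin: "emeasure lborel E < \<infinity>"
      using emeasure_lborel_ball_finite[of "0::real" "real N"] by (auto simp: top.not_eq_extremum[symmetric] top_unique)
    define s where "s = measure lborel E"
    have s: "emeasure lborel E = ennreal s" "s \<ge> 0"
      using fin by (auto simp: s_def emeasure_eq_ennreal_measure)
    have key: "q * s \<le> p * (s + e)" if "e > 0" for e
    proof -
      obtain U where U: "open U" "E \<subseteq> U" "emeasure lborel (U - E) < ennreal e"
        using outer_regular_lborel[of E e] \<open>e > 0\<close> by auto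
      obtain C where C: "countable C" "disjoint_family_on ?B C"
        "\<And>c r. (c, r) \<in> C \<Longrightarrow> 0 < r \<and> - p * (2 * r) < - F (c + r) - - F (c - r)"
        "(\<Union>i\<in>C. ?B i) \<subseteq> U" "negligible (E - (\<Union>i\<in>C. ?B i))"
        by (rule Vitali_balls_in_open[OF U(1,2), of "\<lambda>c r. - p * (2 * r) < - F (c + r) - - F (c - r)"])
           (use steepD[of _ "\<lambda>t. - F t" "- p"] E_sub in blast)+
      define W where "W = (\<Union>i\<in>C. ?B i)"
      have ms: "sets (interval_measure F) = sets borel" by simp
      have W: "open W" unfolding W_def by auto
      then have [measurable]: "W \<in> sets borel" by simp
      have "ennreal q * ennreal s = ennreal q * emeasure lborel (E \<inter> W)"
        using emeasure_le_of_negligible_diff[of E W] C(5) by (simp add: s W_def[symmetric])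
      also have "\<dots> \<le> emeasure (interval_measure F) W"
        by (rule steep_mass[OF mono cont]) (use True \<open>p < q\<close> W in \<open>auto simp: E_def\<close>)
      also have "\<dots> = (\<integral>\<^sup>+i. emeasure (interval_measure F) (?B i) \<partial>count_space C)"
        unfolding W_def by (rule emeasure_countable_UN_balls[OF C(1,2) ms])
      also have "\<dots> \<le> (\<integral>\<^sup>+i. ennreal p * emeasure lborel (?B i) \<partial>count_space C)"
      proof (rule nn_integral_mono)
        fix i assume "i \<in> space (count_space C)"
        then have i: "0 < snd i" "p * (2 * snd i) > F (fst i + snd i) - F (fst i - snd i)"
          using C(3)[of "fst i" "snd i"] by auto
        have "emeasure lborel (?B i) = ennreal (2 * snd i)"
          using i by (simp add: ball_eq_greaterThanLessThan)
        then have "ennreal p * emeasure lborel (?B i) = ennreal (p * (2 * snd i))"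
          using i True by (simp add: ennreal_mult)
        then show "emeasure (interval_measure F) (?B i) \<le> ennreal p * emeasure lborel (?B i)"
          using i by (simp add: emeasure_interval_measure_ball[OF mono cont] ennreal_leI)
      qed
      also have "\<dots> = ennreal p * emeasure lborel W"
        unfolding W_def by (simp add: emeasure_countable_UN_balls[OF C(1,2)] nn_integral_cmult)
      also have "\<dots> \<le> ennreal p * emeasure lborel U"
        using C(4) U(1) by (intro mult_left_mono emeasure_mono) (auto simp: W_def)
      also have "emeasure lborel U = emeasure lborel E + emeasure lborel (U - E)"
        using U by (subst plus_emeasure) (auto intro: arg_cong[where f="emeasure lborel"])
      also have "ennreal p * \<dots> \<le> ennreal p * (ennreal s + ennreal e)"
        using U(3) by (intro mult_left_mono add_mono) (auto simp: s)
      finally show ?thesis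
        using True \<open>p < q\<close> \<open>e > 0\<close> s(2)
        by (simp add: ennreal_mult[symmetric] ennreal_plus[symmetric] del: ennreal_plus)
    qed
    have "(q - p) * s \<le> e" if "e > 0" for e
      using key[of "e / p"] that True by (simp add: algebra_simps)
    then have "(q - p) * s \<le> 0" by (rule field_le_epsilon) simp
    then have "s = 0" using \<open>p < q\<close> s(2) by (simp add: mult_le_0_iff)
    then show ?thesis using s(1) by (simp add: E_def null_sets_def)
  qed
  then have "(\<Union>N::nat. ball 0 (real N) \<inter> (steep F q \<inter> steep (\<lambda>t. - F t) (- p))) \<in> null_sets lborel"
    by (intro null_sets_UN) auto
  also have "(\<Union>N::nat. ball 0 (real N) \<inter> (steep F q \<inter> steep (\<lambda>t. - F t) (- p)))
      = steep F q \<inter> steep (\<lambda>t. - F t) (- p)"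
    by (auto simp: reals_Archimedean2)
  finally show ?thesis .
qed

section \<open>Differentiability and the fundamental theorem for Lipschitz functions\<close>

lemma frequently_slope_imp_steep:
  fixes G :: "real \<Rightarrow> real"
  assumes cont: "continuous_on UNIV G"
    and freq: "frequently (\<lambda>y. (G y - G x) / (y - x) > q) (at x)"
  shows "x \<in> steep G q"
proof -
  have "\<exists>c r. 0 < r \<and> r < d \<and> x \<in> ball c r \<and> q * (2 * r) < G (c + r) - G (c - r)" if "d > 0" for d
  proof -
    have "\<exists>y. (G y - G x) / (y - x) > q \<and> 0 < dist y x \<and> dist y x < d"
      using freq \<open>d > 0\<close> by (auto simp: frequently_def eventually_at)
    then obtain y where y: "(G y - G x) / (y - x) > q" "y \<noteq> x" "\<bar>y - x\<bar> < d"
      by (auto simp: dist_real_def)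
    \<comment> \<open>The interval from \<open>x\<close> to \<open>y\<close> has \<open>x\<close> as an endpoint; a slight enlargement contains \<open>x\<close> in its interior.\<close>
    define a b where "a = min x y" and "b = max x y"
    have ab: "a < b" "b - a < d" "q * (b - a) < G b - G a" and x: "a \<le> x" "x \<le> b"
      using y by (auto simp: a_def b_def field_simps min_def max_def split: if_splits)
    have lim: "((\<lambda>h. G (b + h) - G (a - h) - q * ((b + h) - (a - h))) \<longlongrightarrow> G (b + 0) - G (a - 0) - q * ((b + 0) - (a - 0))) (at_right 0)"
      by (intro tendsto_intros continuous_on_tendsto_compose[OF cont]) auto
    have "\<forall>\<^sub>F h in at_right 0. 0 < G (b + h) - G (a - h) - q * ((b + h) - (a - h))"
      by (rule order_tendstoD(1)[OF lim]) (use ab in simp)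
    moreover have "\<forall>\<^sub>F h in at_right 0. h < d - (b - a)"
      by (rule order_tendstoD(2)[OF tendsto_ident_at]) (use ab in simp)
    moreover have "\<forall>\<^sub>F h in at_right (0::real). 0 < h"
      by (simp add: eventually_at_right_less)
    ultimately have "\<forall>\<^sub>F h in at_right 0. 0 < G (b + h) - G (a - h) - q * ((b + h) - (a - h)) \<and> h < d - (b - a) \<and> 0 < h"
      by eventually_elim auto
    then obtain h where h: "0 < G (b + h) - G (a - h) - q * ((b + h) - (a - h))" "h < d - (b - a)" "0 < h"
      using eventually_happens' trivial_limit_at_right_real by blast
    define c r where "c = (a + b) / 2" and "r = (b - a) / 2 + h"
    have cr: "c + r = b + h" "c - r = a - h" "2 * r = (b + h) - (a - h)"
      by (auto simp: c_def r_def field_simps)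
    have "0 < r" "r < d" unfolding r_def using h(2,3) ab(1,2) by (simp_all only: field_simps)
    moreover have "x \<in> ball c r"
      using x h cr by (auto simp: dist_real_def abs_real_def)
    moreover have "q * (2 * r) < G (c + r) - G (c - r)"
      using h(1) unfolding cr by simp
    ultimately show ?thesis by blast
  qed
  then have "\<exists>c r. 0 < r \<and> r < 1 / Suc n \<and> x \<in> ball c r \<and> q * (2 * r) < G (c + r) - G (c - r)" for n :: nat
    by simp
  then show ?thesis unfolding steep_def by fastforce
qed

lemma AE_differentiable_mono_lipschitz:
  fixes F :: "real \<Rightarrow> real"
  assumes mono: "mono F" and lip: "L-lipschitz_on UNIV F"
  shows "AE x in lborel. F differentiable (at x)"
proof -
  have cont: "continuous_on UNIV F" using lip by (rule lipschitz_on_continuous_on)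
  have "(\<Union>(p, q)\<in>{(p, q). p \<in> \<rat> \<and> q \<in> \<rat> \<and> p < q}. steep F q \<inter> steep (\<lambda>t. - F t) (- p)) \<in> null_sets lborel"
    (is "?N \<in> _")
  proof (rule null_sets_UN')
    show "countable {(p::real, q). p \<in> \<rat> \<and> q \<in> \<rat> \<and> p < q}"
      by (rule countable_subset[of _ "\<rat> \<times> \<rat>"]) (auto intro: countable_SIGMA countable_rat)
  qed (auto intro: steep_flat_null[OF mono cont])
  then show ?thesis
  proof (rule AE_I')
    show "{x \<in> space lborel. \<not> F differentiable (at x)} \<subseteq> ?N"
    proof
      fix x assume "x \<in> {x \<in> space lborel. \<not> F differentiable (at x)}"
      then have nd: "\<not> F differentiable (at x)" by simp
      define Q where "Q = (\<lambda>y. (F y - F x) / (y - x))"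
      have Q: "\<bar>Q y\<bar> \<le> L" if "y \<noteq> x" for y
        using lipschitz_onD[OF lip, of y x] that
        by (auto simp: Q_def dist_real_def divide_simps)
      \<comment> \<open>Finite, since the difference quotients are bounded by \<open>L\<close>; they differ as \<open>F\<close> is not differentiable at \<open>x\<close>.\<close>
      define l u where "l = Liminf (at x) (\<lambda>y. ereal (Q y))" and "u = Limsup (at x) (\<lambda>y. ereal (Q y))"
      have ev: "\<forall>\<^sub>F y in at x. Q y \<le> L" "\<forall>\<^sub>F y in at x. - L \<le> Q y"
        using Q by (auto simp: eventually_at abs_le_iff intro!: exI[of _ 1]) (smt (verit) Q)+
      have "l \<le> u" unfolding l_def u_def by (rule Liminf_le_Limsup) simp
      have "l \<noteq> u"
      proof
        assume "l = u"
        then have t: "((\<lambda>y. ereal (Q y)) \<longlongrightarrow> l) (at x)"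
          unfolding l_def u_def by (intro Liminf_eq_Limsup) auto
        have "l \<le> ereal L" by (rule tendsto_upperbound[OF t]) (use ev in auto)
        moreover have "ereal (- L) \<le> l" by (rule tendsto_lowerbound[OF t]) (use ev in auto)
        ultimately obtain D where "l = ereal D" by (cases l) auto
        then have "(Q \<longlongrightarrow> D) (at x)" using t by simp
        then have "(F has_real_derivative D) (at x)"
          by (simp add: has_field_derivative_iff Q_def)
        then show False using nd by (simp add: real_differentiable_def)
      qed
      then have "l < u" using \<open>l \<le> u\<close> by simp
      then obtain m where m: "l < ereal m" "ereal m < u" by (metis ereal_dense2)
      then obtain m' where m': "ereal m < ereal m'" "ereal m' < u" by (metis ereal_dense2)
      obtain m'' where m'': "l < ereal m''" "ereal m'' < ereal m" using m by (metis ereal_dense2)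
      obtain q where q: "q \<in> \<rat>" "m < q" "q < m'" using Rats_dense_in_real m' by auto
      obtain p where p: "p \<in> \<rat>" "m'' < p" "p < m" using Rats_dense_in_real m'' by auto
      have "frequently (\<lambda>y. (F y - F x) / (y - x) > q) (at x)"
      proof (rule ccontr)
        assume "\<not> ?thesis"
        then have "\<forall>\<^sub>F y in at x. ereal (Q y) \<le> ereal q"
          by (simp add: frequently_def Q_def not_less)
        then have "u \<le> ereal q" unfolding u_def by (rule Limsup_bounded)
        then show False using q m' by (meson less_ereal.simps(1) not_less order.strict_trans)
      qed
      then have 1: "x \<in> steep F q" by (rule frequently_slope_imp_steep[OF cont])
      have "frequently (\<lambda>y. (F y - F x) / (y - x) < p) (at x)"
      proof (rule ccontr)
        assume "\<not> ?thesis"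
        then have "\<forall>\<^sub>F y in at x. ereal p \<le> ereal (Q y)"
          by (simp add: frequently_def Q_def not_less)
        then have "ereal p \<le> l" unfolding l_def by (rule Liminf_bounded)
        then show False using p m'' by (meson less_ereal.simps(1) not_less order.strict_trans)
      qed
      then have "frequently (\<lambda>y. (- F y - - F x) / (y - x) > - p) (at x)"
        by (rule frequently_mono[rotated]) (auto simp: divide_simps algebra_simps split: if_splits)
      then have 2: "x \<in> steep (\<lambda>t. - F t) (- p)"
        by (intro frequently_slope_imp_steep continuous_intros cont)
      show "x \<in> ?N" using 1 2 p q by force
    qed
  qed
qed

lemma AE_differentiable_lipschitz:
  fixes F :: "real \<Rightarrow> real"
  assumes lip: "L-lipschitz_on UNIV F"
  shows "AE x in lborel. F differentiable (at x)"
proof -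
  \<comment> \<open>Adding \<open>L * t\<close> makes the function monotone.\<close>
  have "mono (\<lambda>t. F t + L * t)"
  proof (rule monoI)
    fix x y :: real assume "x \<le> y"
    then show "F x + L * x \<le> F y + L * y"
      using lipschitz_onD[OF lip, of x y] by (auto simp: dist_real_def algebra_simps)
  qed
  moreover have "(L + \<bar>L\<bar> * 1)-lipschitz_on UNIV (\<lambda>t. F t + L * t)"
    by (intro lipschitz_intros lip)
  ultimately have "AE x in lborel. (\<lambda>t. F t + L * t) differentiable (at x)"
    by (rule AE_differentiable_mono_lipschitz)
  then show ?thesis
  proof eventually_elim
    case (elim x)
    then obtain D where "((\<lambda>t. F t + L * t) has_real_derivative D) (at x)"
      by (auto simp: real_differentiable_def)
    from DERIV_diff[OF this DERIV_cmult_Id[of L]] show ?case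
      by (auto simp: real_differentiable_def)
  qed
qed

text \<open>
  The difference quotients of \<open>F\<close> converge to \<open>f\<close> almost everywhere and are bounded by \<open>L\<close>. Their
  integrals are explicit in terms of an antiderivative \<open>G\<close> of \<open>F\<close>, namely
  \<open>(G (b + h) - G b) / h - (G (a + h) - G a) / h\<close>, and converge to \<open>F b - F a\<close>.
\<close>

lemma lipschitz_FTC:
  fixes F f :: "real \<Rightarrow> real"
  assumes lip: "L-lipschitz_on UNIV F" and [measurable]: "f \<in> borel_measurable borel"
    and f: "AE x in lborel. x \<in> {a..b} \<longrightarrow> (F has_real_derivative f x) (at x)" and "a \<le> b"
  shows "set_integrable lborel {a..b} f" "(LINT x:{a..b}|lborel. f x) = F b - F a"
proof -
  have cont: "continuous_on UNIV F" using lip by (rule lipschitz_on_continuous_on)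
  then have [measurable]: "F \<in> borel_measurable borel" by (rule borel_measurable_continuous_onI)
  obtain G where G: "\<And>x. (G has_vector_derivative F x) (at x)"
    using einterval_antiderivative[of "-\<infinity>" "\<infinity>" F] cont
    by (auto simp: continuous_on_eq_continuous_at)
  define h :: "nat \<Rightarrow> real" where "h n = 1 / Suc n" for n
  have h: "h n > 0" for n by (simp add: h_def)
  have h0: "h \<longlonglongrightarrow> 0" unfolding h_def using LIMSEQ_Suc[OF lim_const_over_n[of 1]] by simp
  define D where "D = (\<lambda>n x. indicator {a..b} x *\<^sub>R ((F (x + h n) - F x) / h n))"
  have int: "(\<integral>x. D n x \<partial>lborel) = ((G (b + h n) - G b) / h n - (G (a + h n) - G a) / h n)" for n
  proof -
    have "((\<lambda>x. (G (x + h n) - G x) / h n) has_vector_derivative ((F (x + h n) - F x) / h n)) (at x within {a..b})" for x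
    proof -
      have "((\<lambda>x. G (x + h n)) has_real_derivative F (x + h n)) (at x)"
        using G[of "x + h n"] DERIV_shift[of G] by (simp add: has_real_derivative_iff_has_vector_derivative)
      moreover have "(G has_real_derivative F x) (at x)"
        using G[of x] by (simp add: has_real_derivative_iff_has_vector_derivative)
      ultimately have "((\<lambda>x. (G (x + h n) - G x) / h n) has_real_derivative ((F (x + h n) - F x) / h n)) (at x)"
        by (intro DERIV_cdivide DERIV_diff)
      then have "((\<lambda>x. (G (x + h n) - G x) / h n) has_vector_derivative ((F (x + h n) - F x) / h n)) (at x)"
        by (simp only: has_real_derivative_iff_has_vector_derivative)
      then show ?thesis by (rule has_vector_derivative_at_within)
    qed
    then have "has_bochner_integral lborel (\<lambda>x. indicator {a..b} x *\<^sub>R ((F (x + h n) - F x) / h n))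
       ((G (b + h n) - G b) / h n - (G (a + h n) - G a) / h n)"
      by (intro has_bochner_integral_FTC_Icc \<open>a \<le> b\<close> continuous_intros continuous_on_compose2[OF cont]
           continuous_on_subset[OF cont]) (use h[of n] in auto)
    then show ?thesis unfolding D_def by (rule has_bochner_integral_integral_eq)
  qed
  have lim: "AE x in lborel. (\<lambda>n. D n x) \<longlonglongrightarrow> indicator {a..b} x *\<^sub>R f x"
    using f
  proof eventually_elim
    case (elim x)
    show ?case
    proof (cases "x \<in> {a..b}")
      case True
      then have "((\<lambda>h. (F (x + h) - F x) / h) \<longlongrightarrow> f x) (at 0)"
        using elim by (simp add: DERIV_def)
      moreover have "filterlim h (at 0) sequentially"
        using h0 h by (auto simp: filterlim_at less_imp_neq[symmetric])
      ultimately have "(\<lambda>n. (F (x + h n) - F x) / h n) \<longlonglongrightarrow> f x"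
        by (rule filterlim_compose)
      then show ?thesis using True by (simp add: D_def)
    qed (simp add: D_def)
  qed
  have bound: "AE x in lborel. norm (D n x) \<le> indicator {a..b} x * L" for n
  proof (rule AE_I2)
    fix x
    have "\<bar>F (x + h n) - F x\<bar> \<le> L * h n"
      using lipschitz_onD[OF lip, of "x + h n" x] h[of n] by (simp add: dist_real_def)
    then show "norm (D n x) \<le> indicator {a..b} x * L"
      using h[of n] by (auto simp: D_def indicator_def divide_simps)
  qed
  have w: "integrable lborel (\<lambda>x. indicator {a..b} x * L)"
    by (intro integrable_mult_left integrable_real_indicator) (auto simp: emeasure_lborel_Icc_eq)
  have m: "(\<lambda>x. indicator {a..b} x *\<^sub>R f x) \<in> borel_measurable lborel" "D n \<in> borel_measurable lborel" for n
    unfolding D_def by measurable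
  show "set_integrable lborel {a..b} f"
    unfolding set_integrable_def by (rule integrable_dominated_convergence[OF m w lim bound])
  have "(\<lambda>n. \<integral>x. D n x \<partial>lborel) \<longlonglongrightarrow> (LINT x:{a..b}|lborel. f x)"
    unfolding set_lebesgue_integral_def by (rule integral_dominated_convergence[OF m w lim bound])
  moreover have "(\<lambda>n. (G (y + h n) - G y) / h n) \<longlonglongrightarrow> F y" for y
  proof -
    have "((\<lambda>h. (G (y + h) - G y) / h) \<longlongrightarrow> F y) (at 0)"
      using G[of y] by (simp add: has_real_derivative_iff_has_vector_derivative[symmetric] DERIV_def)
    moreover have "filterlim h (at 0) sequentially"
      using h0 h by (auto simp: filterlim_at less_imp_neq[symmetric])
    ultimately show ?thesis by (rule filterlim_compose)
  qed
  then have "(\<lambda>n. \<integral>x. D n x \<partial>lborel) \<longlonglongrightarrow> F b - F a"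
    unfolding int by (intro tendsto_diff)
  ultimately show "(LINT x:{a..b}|lborel. f x) = F b - F a"
    by (rule LIMSEQ_unique)
qed

lemma locally_lipschitz_imp_lipschitz_on:
  fixes f :: "real \<Rightarrow> real"
  assumes f: "locally_lipschitz f" and K: "compact K"
  obtains L where "L-lipschitz_on K f"
proof -
  have "local_lipschitz {0::real} K (\<lambda>_. f)"
  proof (rule local_lipschitzI)
    fix t x :: real
    obtain e L where "e > 0" "L-lipschitz_on (ball x e) f"
      using f unfolding locally_lipschitz_def by blast
    then have "L-lipschitz_on (cball x (e/2) \<inter> K) f"
      by (auto elim!: lipschitz_on_subset)
    then show "\<exists>u>0. \<exists>L. \<forall>t\<in>cball t u \<inter> {0}. L-lipschitz_on (cball x u \<inter> K) f"
      using \<open>e > 0\<close> by (intro exI[of _ "e/2"]) auto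
  qed
  from local_lipschitz_compact_implies_lipschitz[OF this K]
  show thesis using that by (auto simp: continuous_on_const)
qed

text \<open>
  The retraction of the line onto \<open>[-N, N]\<close>. Composing a locally Lipschitz function with it gives a
  globally Lipschitz function that is unchanged on \<open>[-N, N]\<close>.
\<close>

definition clamp :: "real \<Rightarrow> real \<Rightarrow> real" where "clamp N t = max (- N) (min N t)"

lemma locally_lipschitz_clamp:
  fixes f :: "real \<Rightarrow> real"
  assumes "locally_lipschitz f" "N > 0"
  obtains L where "L-lipschitz_on UNIV (\<lambda>t. f (clamp N t))"
proof -
  obtain L where L: "L-lipschitz_on {-N..N} f"
    using locally_lipschitz_imp_lipschitz_on[OF assms(1) compact_Icc] by blast
  have c: "1-lipschitz_on UNIV (clamp N)"
    by (intro lipschitz_onI) (auto simp: clamp_def dist_real_def)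
  have "clamp N ` UNIV \<subseteq> {-N..N}" using assms(2) by (auto simp: clamp_def)
  then have "(L * 1)-lipschitz_on UNIV (\<lambda>t. f (clamp N t))"
    by (intro lipschitz_on_compose2[OF c] lipschitz_on_subset[OF L])
  then show thesis by (rule that)
qed

lemma has_derivative_clamp_iff:
  fixes f :: "real \<Rightarrow> real"
  assumes "\<bar>x\<bar> < N"
  shows "((\<lambda>t. f (clamp N t)) has_real_derivative D) (at x) \<longleftrightarrow> (f has_real_derivative D) (at x)"
proof (rule DERIV_cong_ev)
  have "\<forall>\<^sub>F t in nhds x. t \<in> {-N<..<N}"
    using assms by (intro eventually_nhds_in_open) auto
  then show "\<forall>\<^sub>F t in nhds x. f (clamp N t) = f t"
    by eventually_elim (auto simp: clamp_def)
qed auto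

lemma AE_differentiable_locally_lipschitz:
  fixes f :: "real \<Rightarrow> real"
  assumes "locally_lipschitz f"
  shows "AE x in lborel. f differentiable (at x)"
proof -
  have "AE x in lborel. \<bar>x\<bar> < real (Suc n) \<longrightarrow> f differentiable (at x)" for n
  proof -
    obtain L where "L-lipschitz_on UNIV (\<lambda>t. f (clamp (Suc n) t))"
      using locally_lipschitz_clamp[OF assms, of "Suc n"] by auto
    from AE_differentiable_lipschitz[OF this] show ?thesis
      by eventually_elim (auto simp: real_differentiable_def has_derivative_clamp_iff)
  qed
  then have "AE x in lborel. \<forall>n. \<bar>x\<bar> < real (Suc n) \<longrightarrow> f differentiable (at x)"
    by (simp only: AE_all_countable) blast
  then show ?thesis
  proof eventually_elim
    case (elim x)
    obtain n where "\<bar>x\<bar> < real n" using reals_Archimedean2 by blast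
    then have "\<bar>x\<bar> < real (Suc n)" by simp
    then show ?case using elim by blast
  qed
qed

lemma locally_lipschitz_FTC:
  fixes F f :: "real \<Rightarrow> real"
  assumes "locally_lipschitz F" and f: "f \<in> borel_measurable borel"
    and "AE x in lborel. (F has_real_derivative f x) (at x)" and "a \<le> b"
  shows "set_integrable lborel {a..b} f" "(LINT x:{a..b}|lborel. f x) = F b - F a"
proof -
  define N where "N = \<bar>a\<bar> + \<bar>b\<bar> + 1"
  have N: "N > 0" "\<bar>a\<bar> < N" "\<bar>b\<bar> < N" "\<And>x. x \<in> {a..b} \<Longrightarrow> \<bar>x\<bar> < N" by (auto simp: N_def)
  obtain L where L: "L-lipschitz_on UNIV (\<lambda>t. F (clamp N t))"
    using locally_lipschitz_clamp[OF assms(1) N(1)] by auto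
  have "AE x in lborel. x \<in> {a..b} \<longrightarrow> ((\<lambda>t. F (clamp N t)) has_real_derivative f x) (at x)"
    using assms(3) by eventually_elim (use N(4) in \<open>simp add: has_derivative_clamp_iff\<close>)
  note * = lipschitz_FTC[OF L f this \<open>a \<le> b\<close>]
  show "set_integrable lborel {a..b} f" by (rule *)
  show "(LINT x:{a..b}|lborel. f x) = F b - F a"
    using *(2) N by (simp add: clamp_def min_def max_def split: if_splits)
qed

section \<open>Measurability of the derivative\<close>

lemma rational_approx_open:
  fixes h :: real
  assumes "open U" "h \<in> U"
  shows "\<exists>r::rat. real_of_rat r \<in> U"
proof -
  obtain e where e: "e > 0" "ball h e \<subseteq> U" using assms openE by blast
  obtain r where "r \<in> \<rat>" "h < r" "r < h + e" using Rats_dense_in_real[of h "h + e"] e by auto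
  moreover from this have "r \<in> U" using e by (auto simp: dist_real_def subset_iff)
  ultimately show ?thesis by (auto elim!: Rats_cases)
qed

text \<open>
  By continuity, the difference quotients need only be tested at rational increments. This leaves
  countably many conditions.
\<close>

lemma has_real_derivative_iff_rational_quotients:
  fixes f :: "real \<Rightarrow> real"
  assumes cont: "continuous_on UNIV f"
  shows "(f has_real_derivative D) (at t) \<longleftrightarrow>
    (\<forall>k::nat. \<exists>m::nat. \<forall>r::rat. 0 < \<bar>real_of_rat r\<bar> \<and> \<bar>real_of_rat r\<bar> < 1 / Suc m \<longrightarrow>
        \<bar>(f (t + real_of_rat r) - f t) / real_of_rat r - D\<bar> \<le> 1 / Suc k)"
    (is "?L \<longleftrightarrow> ?R")
proof
  assume ?L
  then have lim: "((\<lambda>h. (f (t + h) - f t) / h) \<longlongrightarrow> D) (at 0)" by (simp add: DERIV_def)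
  show ?R
  proof
    fix k :: nat
    obtain d where d: "d > 0" "\<And>h. h \<noteq> 0 \<Longrightarrow> \<bar>h\<bar> < d \<Longrightarrow> \<bar>(f (t + h) - f t) / h - D\<bar> < 1 / Suc k"
      using tendstoD[OF lim, of "1 / Suc k"] by (auto simp: eventually_at dist_real_def)
    obtain m where "1 / Suc m < d" using d(1) nat_approx_posE by blast
    then show "\<exists>m::nat. \<forall>r::rat. 0 < \<bar>real_of_rat r\<bar> \<and> \<bar>real_of_rat r\<bar> < 1 / Suc m \<longrightarrow>
        \<bar>(f (t + real_of_rat r) - f t) / real_of_rat r - D\<bar> \<le> 1 / Suc k"
      using d(2) by (intro exI[of _ m]) (auto intro!: less_imp_le)
  qed
next
  assume R: ?R
  have "((\<lambda>h. (f (t + h) - f t) / h) \<longlongrightarrow> D) (at 0)"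
  proof (rule tendstoI)
    fix e :: real assume "e > 0"
    then obtain k where k: "1 / Suc k < e" using nat_approx_posE by blast
    obtain m where m: "\<And>r::rat. 0 < \<bar>real_of_rat r\<bar> \<Longrightarrow> \<bar>real_of_rat r\<bar> < 1 / Suc m \<Longrightarrow>
        \<bar>(f (t + real_of_rat r) - f t) / real_of_rat r - D\<bar> \<le> 1 / Suc k"
      using R by blast
    have "\<bar>(f (t + h) - f t) / h - D\<bar> \<le> 1 / Suc k" if h: "h \<noteq> 0" "\<bar>h\<bar> < 1 / Suc m" for h
    proof (rule ccontr)
      assume "\<not> ?thesis"
      then have gt: "\<bar>(f (t + h) - f t) / h - D\<bar> > 1 / Suc k" by simp
      let ?A = "{h. h \<noteq> 0 \<and> \<bar>h\<bar> < 1 / Suc m}"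
      let ?U = "{h \<in> ?A. 1 / Suc k < \<bar>(f (t + h) - f t) / h - D\<bar>}"
      have A: "open ?A"
        by (intro open_Collect_conj open_Collect_neq open_Collect_less continuous_intros)
      have c: "continuous_on ?A (\<lambda>h. \<bar>(f (t + h) - f t) / h - D\<bar>)"
        by (intro continuous_intros continuous_on_compose2[OF cont]) auto
      have "open (?A \<inter> (\<lambda>h. \<bar>(f (t + h) - f t) / h - D\<bar>) -` {1 / Suc k<..})"
        by (rule continuous_open_preimage[OF c A open_greaterThan])
      also have "?A \<inter> (\<lambda>h. \<bar>(f (t + h) - f t) / h - D\<bar>) -` {1 / Suc k<..} = ?U" by auto
      finally have "open ?U" .
      then obtain r where "real_of_rat r \<in> ?U"
        using rational_approx_open[of ?U h] h gt by auto
      then show False using m[of r] by auto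
    qed
    then show "\<forall>\<^sub>F h in at 0. dist ((f (t + h) - f t) / h) D < e"
      using k by (force simp: eventually_at dist_real_def intro!: exI[of _ "1 / Suc m"])
  qed
  then show ?L by (simp add: DERIV_def)
qed

lemma measurable_deriv_param:
  fixes f :: "'a \<Rightarrow> real \<Rightarrow> real"
  assumes [measurable]: "(\<lambda>(a, t). f a t) \<in> borel_measurable (M \<Otimes>\<^sub>M borel)"
    and cont: "\<And>a. a \<in> space M \<Longrightarrow> continuous_on UNIV (f a)"
  shows "(\<lambda>(a, t). deriv (f a) t) \<in> borel_measurable (M \<Otimes>\<^sub>M borel)"
proof -
  define D where "D = (\<lambda>a t. lim (\<lambda>n. (f a (t + 1 / Suc n) - f a t) / (1 / Suc n)))"
  define P where "P = (\<lambda>a t. \<forall>k::nat. \<exists>m::nat. \<forall>r::rat. 0 < \<bar>real_of_rat r\<bar> \<and> \<bar>real_of_rat r\<bar> < 1 / Suc m \<longrightarrow>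
        \<bar>(f a (t + real_of_rat r) - f a t) / real_of_rat r - D a t\<bar> \<le> 1 / Suc k)"
  have [measurable]: "(\<lambda>x. f (fst x) (snd x + h)) \<in> borel_measurable (M \<Otimes>\<^sub>M borel)" for h
    using measurable_compose[of "\<lambda>x. (fst x, snd x + h)" "M \<Otimes>\<^sub>M borel" "M \<Otimes>\<^sub>M borel", OF _ assms(1)]
    by simp
  have [measurable]: "(\<lambda>x. f (fst x) (snd x)) \<in> borel_measurable (M \<Otimes>\<^sub>M borel)"
    using assms(1) by (simp add: case_prod_beta')
  have [measurable]: "(\<lambda>x. D (fst x) (snd x)) \<in> borel_measurable (M \<Otimes>\<^sub>M borel)"
    unfolding D_def by measurable
  have [measurable]: "Measurable.pred (M \<Otimes>\<^sub>M borel) (\<lambda>x. P (fst x) (snd x))"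
    unfolding P_def by measurable
  \<comment> \<open>Where no derivative exists, \<open>deriv\<close> is the choice from the empty predicate, a constant.\<close>
  have "(\<lambda>x. if P (fst x) (snd x) then D (fst x) (snd x) else (SOME D. False)) \<in> borel_measurable (M \<Otimes>\<^sub>M borel)"
    by measurable
  also have "?this \<longleftrightarrow> ?thesis"
  proof (rule measurable_cong)
    fix x :: "'a \<times> real" assume x: "x \<in> space (M \<Otimes>\<^sub>M borel)"
    obtain a t where at: "x = (a, t)" by (cases x)
    then have "a \<in> space M" using x by (simp add: space_pair_measure)
    note iff = has_real_derivative_iff_rational_quotients[OF cont[OF this], of _ t]
    have D: "D' = D a t" if "(f a has_real_derivative D') (at t)" for D'
    proof -
      have lim: "((\<lambda>h. (f a (t + h) - f a t) / h) \<longlongrightarrow> D') (at 0)" using that by (simp add: DERIV_def)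
      have "(\<lambda>n. 1 / Suc n) \<longlonglongrightarrow> (0::real)" using LIMSEQ_Suc[OF lim_const_over_n[of 1]] by simp
      then have "filterlim (\<lambda>n. 1 / real (Suc n)) (at 0) sequentially" by (auto simp: filterlim_at)
      from filterlim_compose[OF lim this] show ?thesis unfolding D_def by (rule limI[symmetric])
    qed
    show "(if P (fst x) (snd x) then D (fst x) (snd x) else (SOME D. False)) = (case x of (a, t) \<Rightarrow> deriv (f a) t)"
    proof (cases "P a t")
      case True
      then have "(f a has_real_derivative D a t) (at t)" unfolding P_def iff[symmetric] .
      then show ?thesis using True at by (simp add: DERIV_imp_deriv)
    next
      case False
      have "\<not> (f a has_real_derivative D') (at t)" for D'
      proof
        assume d: "(f a has_real_derivative D') (at t)"
        then have "(f a has_real_derivative D a t) (at t)" using D[OF d] by simp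
        then show False using False unfolding iff P_def by blast
      qed
      then show ?thesis using False at by (simp add: deriv_def)
    qed
  qed
  finally show ?thesis .
qed

section \<open>The covariance identity\<close>

text \<open>
  The kernel \<open>(y - m) (1{t \<le> y} - 1{t \<le> m})\<close>: as a function of \<open>t\<close> it is \<open>|y - m|\<close> on the half-open
  interval between \<open>m\<close> and \<open>y\<close>, and zero elsewhere.
\<close>

definition stein_kernel :: "real \<Rightarrow> real \<Rightarrow> real \<Rightarrow> real" where
  "stein_kernel m y t = (y - m) * (of_bool (t \<le> y) - of_bool (t \<le> m))"

lemma stein_kernel_nonneg: "stein_kernel m y t \<ge> 0"
  by (auto simp: stein_kernel_def of_bool_def)

lemma stein_kernel_le: "stein_kernel m y t \<le> \<bar>y - m\<bar>"
  by (auto simp: stein_kernel_def of_bool_def)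

lemma stein_kernel_eq:
  "stein_kernel m y t = (y - m) * indicator {m<..y} t + (m - y) * indicator {y<..m} t"
  by (auto simp: stein_kernel_def of_bool_def indicator_def)

lemma integral_stein_kernel:
  fixes F f :: "real \<Rightarrow> real"
  assumes "locally_lipschitz F" and f[measurable]: "f \<in> borel_measurable borel"
    and "AE x in lborel. (F has_real_derivative f x) (at x)"
  shows "(\<integral>t. f t * stein_kernel m y t \<partial>lborel) = (y - m) * (F y - F m)"
proof -
  have *: "(\<integral>t. f t * indicator {a<..b} t \<partial>lborel) = F b - F a" if "a \<le> b" for a b
  proof -
    have "(\<integral>t. f t * indicator {a<..b} t \<partial>lborel) = (LINT x:{a..b}|lborel. f x)"
      unfolding set_lebesgue_integral_def
      by (rule integral_cong_AE, measurable)
         (use AE_lborel_singleton[of a] in eventually_elim, auto simp: indicator_def)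
    also have "\<dots> = F b - F a" by (rule locally_lipschitz_FTC[OF assms that])
    finally show ?thesis .
  qed
  show ?thesis
  proof (cases "m \<le> y")
    case True
    then have "(\<integral>t. f t * stein_kernel m y t \<partial>lborel) = (\<integral>t. (y - m) * (f t * indicator {m<..y} t) \<partial>lborel)"
      by (simp add: stein_kernel_eq mult_ac)
    then show ?thesis using *[OF True] by simp
  next
    case False
    then have "(\<integral>t. f t * stein_kernel m y t \<partial>lborel) = (\<integral>t. (m - y) * (f t * indicator {y<..m} t) \<partial>lborel)"
      by (simp add: stein_kernel_eq mult_ac)
    also have "\<dots> = (m - y) * (F m - F y)" using *[of y m] False by simp
    finally show ?thesis by (simp add: algebra_simps)
  qed
qed

lemma (in sigma_finite_subalgebra) nn_integral_mult_real_cond_exp: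
  fixes K :: "'a \<Rightarrow> real"
  assumes [measurable]: "f \<in> borel_measurable F" and K: "integrable M K" "\<And>x. K x \<ge> 0"
  shows "(\<integral>\<^sup>+x. f x * ennreal (K x) \<partial>M) = (\<integral>\<^sup>+x. f x * ennreal (real_cond_exp M F K x) \<partial>M)"
proof -
  have [measurable]: "K \<in> borel_measurable M" using K by simp
  have 0: "AE x in M. nn_cond_exp M F (\<lambda>x. ennreal (- K x)) x = 0"
    using nn_cond_exp_F_meas[of "\<lambda>x. 0"] K(2) by (simp add: ennreal_neg)
  have "(\<integral>\<^sup>+x. nn_cond_exp M F (\<lambda>x. ennreal (K x)) x \<partial>M) = (\<integral>\<^sup>+x. ennreal (K x) \<partial>M)"
    using nn_cond_exp_intg[of "\<lambda>_. 1" "\<lambda>x. ennreal (K x)"] by simp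
  also have "\<dots> \<noteq> \<infinity>" using integrableD(2)[OF K(1)] K(2) by (simp add: nn_integral_eq_integral[OF K(1)])
  finally have "AE x in M. nn_cond_exp M F (\<lambda>x. ennreal (K x)) x \<noteq> \<infinity>"
    by (intro nn_integral_PInf_AE) auto
  with 0 have "AE x in M. ennreal (real_cond_exp M F K x) = nn_cond_exp M F (\<lambda>x. ennreal (K x)) x"
    by eventually_elim (simp add: real_cond_exp_def less_top)
  then have "(\<integral>\<^sup>+x. f x * ennreal (real_cond_exp M F K x) \<partial>M) = (\<integral>\<^sup>+x. f x * nn_cond_exp M F (\<lambda>x. ennreal (K x)) x \<partial>M)"
    by (intro nn_integral_cong_AE) (auto elim: eventually_mono)
  also have "\<dots> = (\<integral>\<^sup>+x. f x * ennreal (K x) \<partial>M)"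
    by (rule nn_cond_exp_intg) auto
  finally show ?thesis by simp
qed

text \<open>
  The data of the covariance identity: an \<open>F\<close>-measurable \<open>S\<close>, an integrable \<open>V\<close>, locally Lipschitz
  functions \<open>phi s\<close> with almost everywhere derivative \<open>p s\<close>, and a jointly measurable version \<open>c\<close> of
  \<open>E[(V - E[V | F]) 1{t \<le> V} | F]\<close>, as a function of \<open>S\<close> and \<open>t\<close>.
\<close>

locale conditional_covariance = finite_measure_subalgebra +
  fixes S V :: "'a \<Rightarrow> real" and phi p c :: "real \<Rightarrow> real \<Rightarrow> real"
  assumes S[measurable]: "S \<in> borel_measurable F"
    and V: "integrable M V"
    and phi[measurable]: "(\<lambda>(s, t). phi s t) \<in> borel_measurable (borel \<Otimes>\<^sub>M borel)"
    and phi_lip: "\<And>s. locally_lipschitz (phi s)"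
    and p[measurable]: "(\<lambda>(s, t). p s t) \<in> borel_measurable (borel \<Otimes>\<^sub>M borel)"
    and p_deriv: "\<And>s. AE t in lborel. (phi s has_real_derivative p s t) (at t)"
    and c[measurable]: "(\<lambda>(s, t). c s t) \<in> borel_measurable (borel \<Otimes>\<^sub>M borel)"
    and c_cond: "\<And>t. AE z in M. c (S z) t =
          real_cond_exp M F (\<lambda>z. (V z - real_cond_exp M F V z) * of_bool (t \<le> V z)) z"
    and fin: "(\<integral>\<^sup>+z. (\<integral>\<^sup>+t. ennreal \<bar>p (S z) t * c (S z) t\<bar> \<partial>lborel) \<partial>M) < \<infinity>"
begin

sublocale sigma_finite_subalgebra M F
  by (rule finite_measure_subalgebra_is_sigma_finite) unfold_locales

sublocale pair_sigma_finite M lborel ..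

abbreviation "m \<equiv> real_cond_exp M F V"

lemma S_M[measurable]: "S \<in> borel_measurable M" by (rule measurable_from_subalg[OF subalg S])
lemma V_M[measurable]: "V \<in> borel_measurable M" using V by simp

lemma m_int: "integrable M m" by (rule real_cond_exp_int(1)[OF V])

lemma centred: "AE z in M. real_cond_exp M F (\<lambda>z. V z - m z) z = 0"
proof -
  have "AE z in M. real_cond_exp M F (\<lambda>z. V z - m z) z = m z - real_cond_exp M F m z"
    by (rule real_cond_exp_diff[OF V m_int])
  moreover have "AE z in M. real_cond_exp M F m z = m z"
    by (rule real_cond_exp_F_meas[OF m_int]) simp
  ultimately show ?thesis by eventually_elim simp
qed

lemma kernel_M[measurable]: "(\<lambda>(z, t). stein_kernel (m z) (V z) t) \<in> borel_measurable (M \<Otimes>\<^sub>M lborel)"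
  unfolding stein_kernel_def by measurable

lemma kernel_int: "integrable M (\<lambda>z. stein_kernel (m z) (V z) t)"
proof (rule Bochner_Integration.integrable_bound[of M "\<lambda>z. V z - m z"])
  show "integrable M (\<lambda>z. V z - m z)" using V m_int by simp
  show "(\<lambda>z. stein_kernel (m z) (V z) t) \<in> borel_measurable M"
    unfolding stein_kernel_def by measurable
qed (use stein_kernel_nonneg stein_kernel_le in \<open>simp\<close>)

lemma kernel_cond: "AE z in M. real_cond_exp M F (\<lambda>z. stein_kernel (m z) (V z) t) z = c (S z) t"
proof -
  let ?a = "\<lambda>z. (V z - m z) * of_bool (t \<le> V z)"
  let ?b = "\<lambda>z. of_bool (t \<le> m z) * (V z - m z)"
  have d: "integrable M (\<lambda>z. V z - m z)" using V m_int by simp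
  have a: "integrable M ?a" and b: "integrable M ?b"
    by (auto intro!: Bochner_Integration.integrable_bound[OF d])
  have "AE z in M. real_cond_exp M F (\<lambda>z. ?a z - ?b z) z = real_cond_exp M F ?a z - real_cond_exp M F ?b z"
    by (rule real_cond_exp_diff[OF a b])
  moreover have "AE z in M. real_cond_exp M F ?b z = of_bool (t \<le> m z) * real_cond_exp M F (\<lambda>z. V z - m z) z"
    by (rule real_cond_exp_mult[OF _ _ b]) auto
  moreover have "(\<lambda>z. stein_kernel (m z) (V z) t) = (\<lambda>z. ?a z - ?b z)"
    by (auto simp: stein_kernel_def algebra_simps)
  ultimately show ?thesis
    using centred c_cond[of t] by (auto elim!: eventually_elim2 eventually_rev_mp)
qed

lemma nn_kernel_eq:
  "(\<integral>\<^sup>+z. ennreal \<bar>p (S z) t * stein_kernel (m z) (V z) t\<bar> \<partial>M) = (\<integral>\<^sup>+z. ennreal \<bar>p (S z) t * c (S z) t\<bar> \<partial>M)"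
proof -
  have "(\<integral>\<^sup>+z. ennreal \<bar>p (S z) t * stein_kernel (m z) (V z) t\<bar> \<partial>M)
      = (\<integral>\<^sup>+z. ennreal \<bar>p (S z) t\<bar> * ennreal (stein_kernel (m z) (V z) t) \<partial>M)"
    by (simp add: abs_mult ennreal_mult stein_kernel_nonneg)
  also have "\<dots> = (\<integral>\<^sup>+z. ennreal \<bar>p (S z) t\<bar> * ennreal (real_cond_exp M F (\<lambda>z. stein_kernel (m z) (V z) t) z) \<partial>M)"
    by (rule nn_integral_mult_real_cond_exp[OF _ kernel_int stein_kernel_nonneg]) simp
  also have "\<dots> = (\<integral>\<^sup>+z. ennreal \<bar>p (S z) t * c (S z) t\<bar> \<partial>M)"
  proof (rule nn_integral_cong_AE)
    have "AE z in M. real_cond_exp M F (\<lambda>z. stein_kernel (m z) (V z) t) z \<ge> 0"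
      by (rule real_cond_exp_pos) (use kernel_int[of t] stein_kernel_nonneg in auto)
    with kernel_cond[of t] show "AE z in M. ennreal \<bar>p (S z) t\<bar> * ennreal (real_cond_exp M F (\<lambda>z. stein_kernel (m z) (V z) t) z)
        = ennreal \<bar>p (S z) t * c (S z) t\<bar>"
      by eventually_elim (simp add: abs_mult ennreal_mult)
  qed
  finally show ?thesis .
qed

lemma pc_int: "integrable (M \<Otimes>\<^sub>M lborel) (\<lambda>(z, t). p (S z) t * c (S z) t)"
proof (rule integrableI_bounded)
  have "(\<integral>\<^sup>+x. ennreal (norm (case x of (z, t) \<Rightarrow> p (S z) t * c (S z) t)) \<partial>(M \<Otimes>\<^sub>M lborel))
     = (\<integral>\<^sup>+z. (\<integral>\<^sup>+t. ennreal \<bar>p (S z) t * c (S z) t\<bar> \<partial>lborel) \<partial>M)"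
    by (subst lborel.nn_integral_fst[symmetric]) auto
  then show "(\<integral>\<^sup>+x. ennreal (norm (case x of (z, t) \<Rightarrow> p (S z) t * c (S z) t)) \<partial>(M \<Otimes>\<^sub>M lborel)) < \<infinity>"
    using fin by simp
qed measurable

lemma pK_int: "integrable (M \<Otimes>\<^sub>M lborel) (\<lambda>(z, t). p (S z) t * stein_kernel (m z) (V z) t)"
proof (rule integrableI_bounded)
  have "(\<integral>\<^sup>+x. ennreal (norm (case x of (z, t) \<Rightarrow> p (S z) t * stein_kernel (m z) (V z) t)) \<partial>(M \<Otimes>\<^sub>M lborel))
     = (\<integral>\<^sup>+t. (\<integral>\<^sup>+z. ennreal \<bar>p (S z) t * stein_kernel (m z) (V z) t\<bar> \<partial>M) \<partial>lborel)"
    by (subst nn_integral_snd[symmetric]) (auto simp: case_prod_beta')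
  also have "\<dots> = (\<integral>\<^sup>+t. (\<integral>\<^sup>+z. ennreal \<bar>p (S z) t * c (S z) t\<bar> \<partial>M) \<partial>lborel)"
    by (simp only: nn_kernel_eq)
  also have "\<dots> = (\<integral>\<^sup>+z. (\<integral>\<^sup>+t. ennreal \<bar>p (S z) t * c (S z) t\<bar> \<partial>lborel) \<partial>M)"
    by (rule Fubini') measurable
  finally show "(\<integral>\<^sup>+x. ennreal (norm (case x of (z, t) \<Rightarrow> p (S z) t * stein_kernel (m z) (V z) t)) \<partial>(M \<Otimes>\<^sub>M lborel)) < \<infinity>"
    using fin by simp
qed measurable

text \<open>
  Both sides are \<open>E[\<integral> p(S, t) K(t) dt]\<close> for the kernel \<open>K\<close>: on the left by the fundamental theorem of
  calculus, on the right by conditioning for fixed \<open>t\<close> and Fubini.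
\<close>

lemma covariance_formula:
  "integrable M (\<lambda>z. (V z - m z) * (phi (S z) (V z) - phi (S z) (m z)))"
  "(\<integral>z. (V z - m z) * (phi (S z) (V z) - phi (S z) (m z)) \<partial>M) = (\<integral>z. (\<integral>t. p (S z) t * c (S z) t \<partial>lborel) \<partial>M)"
proof -
  have ps: "p s \<in> borel_measurable borel" for s by measurable
  have eq: "(\<integral>t. p (S z) t * stein_kernel (m z) (V z) t \<partial>lborel) = (V z - m z) * (phi (S z) (V z) - phi (S z) (m z))" for z
    by (rule integral_stein_kernel[OF phi_lip ps p_deriv])
  show "integrable M (\<lambda>z. (V z - m z) * (phi (S z) (V z) - phi (S z) (m z)))"
    using integrable_fst[OF pK_int] by (simp add: eq)
  have "(\<integral>z. (V z - m z) * (phi (S z) (V z) - phi (S z) (m z)) \<partial>M) = (\<integral>t. (\<integral>z. p (S z) t * stein_kernel (m z) (V z) t \<partial>M) \<partial>lborel)"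
    using Fubini_integral[OF pK_int] by (simp add: eq)
  also have "\<dots> = (\<integral>t. (\<integral>z. p (S z) t * c (S z) t \<partial>M) \<partial>lborel)"
  proof (rule integral_cong_AE)
    show "AE t in lborel. (\<integral>z. p (S z) t * stein_kernel (m z) (V z) t \<partial>M) = (\<integral>z. p (S z) t * c (S z) t \<partial>M)"
      using AE_integrable_snd[OF pK_int]
    proof eventually_elim
      case (elim t)
      have K: "(\<lambda>z. stein_kernel (m z) (V z) t) \<in> borel_measurable M" using kernel_int by simp
      have "(\<integral>z. p (S z) t * stein_kernel (m z) (V z) t \<partial>M)
          = (\<integral>z. p (S z) t * real_cond_exp M F (\<lambda>z. stein_kernel (m z) (V z) t) z \<partial>M)"
        by (rule real_cond_exp_intg(2)[symmetric, OF elim _ K]) measurable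
      also have "\<dots> = (\<integral>z. p (S z) t * c (S z) t \<partial>M)"
        by (rule integral_cong_AE) (use kernel_cond[of t] in \<open>auto elim: eventually_mono\<close>)
      finally show ?case .
    qed
  qed measurable
  also have "\<dots> = (\<integral>z. (\<integral>t. p (S z) t * c (S z) t \<partial>lborel) \<partial>M)"
    by (rule Fubini_integral[OF pc_int])
  finally show "(\<integral>z. (V z - m z) * (phi (S z) (V z) - phi (S z) (m z)) \<partial>M) = (\<integral>z. (\<integral>t. p (S z) t * c (S z) t \<partial>lborel) \<partial>M)" .
qed

lemma integral_phi_V:
  assumes h: "integrable M (\<lambda>z. phi (S z) (V z))" and hV: "integrable M (\<lambda>z. phi (S z) (V z) * V z)"
    and hm: "integrable M (\<lambda>z. real_cond_exp M F (\<lambda>z. phi (S z) (V z)) z * m z)"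
  shows "(\<integral>z. phi (S z) (V z) * V z \<partial>M) =
      (\<integral>z. real_cond_exp M F (\<lambda>z. phi (S z) (V z)) z * m z \<partial>M) + (\<integral>z. (\<integral>t. p (S z) t * c (S z) t \<partial>lborel) \<partial>M)"
proof -
  define H where "H = (\<lambda>z. phi (S z) (V z))"
  define R where "R = (\<lambda>z. phi (S z) (m z))"
  define G where "G = (\<lambda>z. (V z - m z) * (H z - R z))"
  have [measurable]: "H \<in> borel_measurable M" "R \<in> borel_measurable F"
    unfolding H_def R_def by measurable
  have RM[measurable]: "R \<in> borel_measurable M" by (rule measurable_from_subalg[OF subalg]) simp
  have G: "integrable M G" using covariance_formula(1) by (simp add: G_def H_def R_def)
  \<comment> \<open>Indicators of an exhausting sequence of \<open>F\<close>-measurable events on which \<open>m\<close> and \<open>R\<close> are bounded.\<close>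
  define I :: "nat \<Rightarrow> 'a \<Rightarrow> real" where "I n z = of_bool (\<bar>m z\<bar> \<le> real n \<and> \<bar>R z\<bar> \<le> real n)" for n z
  have [measurable]: "I n \<in> borel_measurable F" for n unfolding I_def by measurable
  have [measurable]: "I n \<in> borel_measurable M" for n by (rule measurable_from_subalg[OF subalg]) simp
  have I_lim: "(\<lambda>n. I n z * y) \<longlonglongrightarrow> y" for z y
  proof -
    obtain N where N: "max \<bar>m z\<bar> \<bar>R z\<bar> \<le> real N" using real_arch_simple by blast
    have "\<forall>\<^sub>F n in sequentially. I n z * y = y"
      using eventually_ge_at_top[of N] by eventually_elim (use N in \<open>auto simp: I_def\<close>)
    then show ?thesis by (rule tendsto_eventually)
  qed
  have I_bd: "\<bar>I n z * y\<bar> \<le> \<bar>y\<bar>" for n z y by (simp add: I_def)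
  have lim: "(\<lambda>n. \<integral>z. I n z * f z \<partial>M) \<longlonglongrightarrow> (\<integral>z. f z \<partial>M)" if "integrable M f" for f
    by (rule integral_dominated_convergence[of _ _ _ "\<lambda>z. \<bar>f z\<bar>"]) (use that I_lim I_bd in auto)
  have int: "integrable M (\<lambda>z. I n z * f z)" if "integrable M f" for f n
    by (rule Bochner_Integration.integrable_bound[OF that]) (use that I_bd in auto)
  have intb: "integrable M (\<lambda>z. (I n z * g z) * f z)"
    if "integrable M f" "g \<in> borel_measurable M" "\<And>z. \<bar>I n z * g z\<bar> \<le> real n" for f g n
  proof (rule Bochner_Integration.integrable_bound[of _ "\<lambda>z. real n * f z"])
    show "AE z in M. norm (I n z * g z * f z) \<le> norm (real n * f z)"
      using that(3) by (auto simp: abs_mult intro!: mult_right_mono AE_I2)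
  qed (use that in auto)
  have "(\<integral>z. I n z * (H z * V z) \<partial>M) = (\<integral>z. I n z * (real_cond_exp M F H z * m z) \<partial>M) + (\<integral>z. I n z * G z \<partial>M)" for n
  proof -
    have 1: "integrable M (\<lambda>z. (I n z * m z) * H z)"
      by (rule intb) (use h in \<open>auto simp: H_def I_def\<close>)
    have 2: "integrable M (\<lambda>z. (I n z * R z) * (V z - m z))"
      by (rule intb) (use V m_int in \<open>auto simp: I_def\<close>)
    have "(\<integral>z. I n z * (H z * V z) \<partial>M) = (\<integral>z. ((I n z * m z) * H z + (I n z * R z) * (V z - m z)) + I n z * G z \<partial>M)"
      by (simp add: G_def algebra_simps)
    also have "\<dots> = (\<integral>z. (I n z * m z) * H z \<partial>M) + (\<integral>z. (I n z * R z) * (V z - m z) \<partial>M) + (\<integral>z. I n z * G z \<partial>M)"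
      by (simp add: 1 2 int[OF G])
    also have "(\<integral>z. (I n z * m z) * H z \<partial>M) = (\<integral>z. (I n z * m z) * real_cond_exp M F H z \<partial>M)"
      by (rule real_cond_exp_intg(2)[symmetric, OF 1]) measurable
    also have "(\<integral>z. (I n z * R z) * (V z - m z) \<partial>M) = (\<integral>z. (I n z * R z) * real_cond_exp M F (\<lambda>z. V z - m z) z \<partial>M)"
      by (rule real_cond_exp_intg(2)[symmetric, OF 2]) measurable
    also have "\<dots> = (\<integral>z. 0 \<partial>M)"
      by (rule integral_cong_AE) (use centred in \<open>auto elim: eventually_mono\<close>)
    finally show ?thesis by (simp add: mult_ac)
  qed
  then have "(\<lambda>n. \<integral>z. I n z * (H z * V z) \<partial>M) \<longlonglongrightarrow> (\<integral>z. real_cond_exp M F H z * m z \<partial>M) + (\<integral>z. G z \<partial>M)"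
    by (simp only:) (intro tendsto_add lim G, use hm in \<open>simp add: H_def\<close>)
  moreover have "(\<lambda>n. \<integral>z. I n z * (H z * V z) \<partial>M) \<longlonglongrightarrow> (\<integral>z. H z * V z \<partial>M)"
    by (rule lim) (use hV in \<open>simp add: H_def\<close>)
  ultimately have "(\<integral>z. H z * V z \<partial>M) = (\<integral>z. real_cond_exp M F H z * m z \<partial>M) + (\<integral>z. G z \<partial>M)"
    using LIMSEQ_unique by blast
  then show ?thesis
    using covariance_formula(2) by (simp add: H_def G_def R_def)
qed

end

section \<open>The gradient bound\<close>

lemma perp_inner: "perp x z \<bullet> w = z \<bullet> w - (x \<bullet> z) * (x \<bullet> w)"
  by (simp add: perp_def inner_diff_left)

lemma locally_lipschitz_imp_continuous_on:
  assumes "locally_lipschitz f"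
  shows "continuous_on UNIV f"
proof -
  have "isCont f x" for x
  proof -
    obtain e L where "e > 0" "L-lipschitz_on (ball x e) f"
      using assms unfolding locally_lipschitz_def by blast
    then have "continuous_on (ball x e) f" by (auto intro: lipschitz_on_continuous_on)
    then show ?thesis
      using \<open>e > 0\<close> by (simp add: continuous_on_eq_continuous_at)
  qed
  then show ?thesis by (simp add: continuous_on_eq_continuous_at)
qed

lemma locally_lipschitz_affine:
  fixes f :: "real \<Rightarrow> real"
  assumes "locally_lipschitz f"
  shows "locally_lipschitz (\<lambda>t. f (a + t * b))"
  unfolding locally_lipschitz_def
proof
  fix u
  obtain e L where eL: "e > 0" "L-lipschitz_on (ball (a + u * b) e) f"
    using assms unfolding locally_lipschitz_def by blast
  define d where "d = e / (\<bar>b\<bar> + 1)"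
  have "d > 0" using eL(1) by (simp add: d_def)
  have "\<bar>b\<bar>-lipschitz_on (ball u d) (\<lambda>t. a + t * b)"
    by (rule lipschitz_onI) (auto simp: dist_real_def abs_mult[symmetric] algebra_simps)
  moreover have "(\<lambda>t. a + t * b) ` ball u d \<subseteq> ball (a + u * b) e"
  proof clarify
    fix t assume "t \<in> ball u d"
    then have "\<bar>u - t\<bar> * (\<bar>b\<bar> + 1) < e" by (simp add: d_def dist_real_def field_simps)
    moreover have "\<bar>u * b - t * b\<bar> \<le> \<bar>u - t\<bar> * (\<bar>b\<bar> + 1)"
      by (simp add: left_diff_distrib[symmetric] abs_mult mult_left_mono)
    ultimately show "a + t * b \<in> ball (a + u * b) e" by (simp add: dist_real_def)
  qed
  ultimately have "(L * \<bar>b\<bar>)-lipschitz_on (ball u d) (\<lambda>t. f (a + t * b))"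
    by (intro lipschitz_on_compose2 lipschitz_on_subset[OF eL(2)])
  then show "\<exists>e>0. \<exists>L. L-lipschitz_on (ball u e) (\<lambda>t. f (a + t * b))"
    using \<open>d > 0\<close> by blast
qed

lemma AE_lborel_affine:
  assumes "AE x in lborel. P (x::real)" "b \<noteq> 0"
  shows "AE t in lborel. P (a + t * b)"
proof -
  have "AE x in density (distr lborel borel (\<lambda>t. a + b * t)) (\<lambda>_. ennreal \<bar>b\<bar>). P x"
    using assms by (simp only: lborel_real_affine[OF assms(2), of a, symmetric])
  then have "AE x in distr lborel borel (\<lambda>t. a + b * t). P x"
    using assms(2) by (simp add: AE_density)
  then have "AE t in lborel. P (a + b * t)"
    by (rule AE_distrD[rotated]) simp
  then show ?thesis by (simp add: mult.commute)
qed


theorem theorem4p5: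
  fixes D :: "(real ^ 'd) measure"
    and l dl :: "real \<Rightarrow> real \<Rightarrow> real ^ 'd \<Rightarrow> real ^ 'd \<Rightarrow> real"
    and x xs v :: "real ^ 'd"
    and c :: "real \<Rightarrow> real \<Rightarrow> real"
    and \<theta> \<mu>1 \<mu>2 :: real
  assumes D: "prob_space D" "sets D = sets borel"
    and xs: "xs \<in> sphere 0 1"
    and l_lip: "\<forall>u2 y ys. locally_lipschitz (\<lambda>u1. l u1 u2 y ys)"
    and dl: "partial1_selection l dl"
    and x: "x \<in> sphere 0 1"
    and \<theta>: "\<theta> = theta x xs" "0 < \<theta>" "\<theta> < pi / 2"
    and v: "v = perp x xs /\<^sub>R norm (perp x xs)"
    and c: "is_cond_c D x v c"
    \<comment> \<open>the expectations and conditional expectations involved exist and are finite\<close>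
    and g_ex: "\<forall>y\<in>sphere 0 1. integrable D (grad_integrand dl y xs)"
    and dl_ex: "integrable D (\<lambda>z. dl (x \<bullet> z) (xs \<bullet> z) x xs)"
    and v_ex: "integrable D (\<lambda>z. v \<bullet> z)"
    and a_ex: "integrable D (\<lambda>z. cond_exp_proj D x (\<lambda>w. dl (x \<bullet> w) (xs \<bullet> w) x xs) z
                               * cond_exp_proj D x (\<lambda>w. v \<bullet> w) z)"
    and mu: "\<mu>1 \<ge> 0" "\<mu>2 \<ge> 0" "\<mu>1 + \<mu>2 > 0"
    and a: "(\<integral>z. cond_exp_proj D x (\<lambda>w. dl (x \<bullet> w) (xs \<bullet> w) x xs) z
                * cond_exp_proj D x (\<lambda>w. v \<bullet> w) z \<partial>D) \<le> - \<mu>1"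
    and b_lip: "\<forall>u1. locally_lipschitz (\<lambda>u2. dl u1 u2 x xs)"
    and b_fin: "(\<integral>\<^sup>+s. (\<integral>\<^sup>+t. ennreal \<bar>partial2 dl s (s * cos \<theta> + t * sin \<theta>) x xs * c s t\<bar>
                   \<partial>lborel) \<partial>law_proj D x) < \<infinity>"
    and b: "(\<integral>s. (\<integral>t. partial2 dl s (s * cos \<theta> + t * sin \<theta>) x xs * c s t
                   \<partial>lborel) \<partial>law_proj D x) \<le> - \<mu>2"
  shows "(\<forall>L1>0. (\<forall>y\<in>sphere 0 1. norm (g_loss D dl y xs) \<le> L1) \<longrightarrow>
            g_loss D dl x xs \<bullet> xs
              \<le> - ((\<mu>1 + \<mu>2 * sin \<theta>) / L1) * sin \<theta> * norm (g_loss D dl x xs)) \<and>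
         (\<forall>L2>0. (\<forall>y\<in>sphere 0 1. norm (g_loss D dl y xs) \<le> L2 * norm (y - xs)) \<longrightarrow>
            g_loss D dl x xs \<bullet> xs
              \<le> - ((\<mu>1 + \<mu>2 * sin \<theta>) / (2 * L2)) * norm (g_loss D dl x xs))"
proof -
  interpret prob_space D by (rule D)
  have sp: "space D = UNIV" using sets_eq_imp_space_eq[OF D(2)] by simp
  note meas = D(2)[measurable_cong]
  define F where "F = vimage_algebra (space D) (\<lambda>z. x \<bullet> z) borel"
  have S_F: "(\<lambda>z. x \<bullet> z) \<in> borel_measurable F"
    unfolding F_def by (rule measurable_vimage_algebra1) simp
  have sub: "subalgebra D F"
    unfolding subalgebra_def F_def using sets_image_in_sets[of D "space D" "\<lambda>z. x \<bullet> z" borel]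
    by simp
  have cep: "cond_exp_proj D x f = real_cond_exp D F f" for f
    by (simp add: cond_exp_proj_def F_def)
  have nx: "norm x = 1" "norm xs = 1" using x xs by simp_all
  have xx: "x \<bullet> x = 1" "xs \<bullet> xs = 1" using nx by (simp_all add: norm_eq_1)
  have "\<bar>x \<bullet> xs\<bar> \<le> 1" using Cauchy_Schwarz_ineq2[of x xs] nx by simp
  then have cos: "x \<bullet> xs = cos \<theta>" using \<theta>(1) by (simp add: theta_def cos_arccos_abs)
  have sin: "sin \<theta> > 0" using \<theta> by (intro sin_gt_zero) auto
  have "norm (perp x xs) ^ 2 = 1 - cos \<theta> ^ 2"
    unfolding power2_norm_eq_inner perp_inner
    by (simp add: perp_def inner_diff_right inner_diff_left xx cos inner_commute[of xs x] power2_eq_square)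
  then have "norm (perp x xs) ^ 2 = sin \<theta> ^ 2" by (simp add: sin_squared_eq)
  then have np: "norm (perp x xs) = sin \<theta>" using sin by (simp add: power2_eq_iff_nonneg)
  have xs_eq: "xs = cos \<theta> *\<^sub>R x + sin \<theta> *\<^sub>R v"
  proof -
    have "sin \<theta> *\<^sub>R v = perp x xs" using sin by (simp add: v np)
    then show ?thesis by (simp add: perp_def cos)
  qed
  have xsz: "xs \<bullet> z = (x \<bullet> z) * cos \<theta> + (v \<bullet> z) * sin \<theta>" for z
    by (subst xs_eq) (simp add: inner_add_left)
  define phi where "phi = (\<lambda>s t. dl s (s * cos \<theta> + t * sin \<theta>) x xs)"
  define p where "p = (\<lambda>s t. partial2 dl s (s * cos \<theta> + t * sin \<theta>) x xs * sin \<theta>)"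
  have dl_meas: "(\<lambda>(s, u). dl s u x xs) \<in> borel_measurable (borel \<Otimes>\<^sub>M borel)"
    using dl unfolding partial1_selection_def by blast
  have aff: "(\<lambda>(s, t). (s, s * cos \<theta> + t * sin \<theta>)) \<in> borel \<Otimes>\<^sub>M borel \<rightarrow>\<^sub>M borel \<Otimes>\<^sub>M (borel :: real measure)"
    by measurable
  have phi_meas: "(\<lambda>(s, t). phi s t) \<in> borel_measurable (borel \<Otimes>\<^sub>M borel)"
    using measurable_compose[OF aff dl_meas] by (simp add: phi_def case_prod_beta')
  have "(\<lambda>(s, u). deriv (\<lambda>u. dl s u x xs) u) \<in> borel_measurable (borel \<Otimes>\<^sub>M borel)"
    by (rule measurable_deriv_param[OF dl_meas]) (use b_lip locally_lipschitz_imp_continuous_on in blast)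
  from measurable_compose[OF aff this]
  have p2_meas: "(\<lambda>(s, t). partial2 dl s (s * cos \<theta> + t * sin \<theta>) x xs) \<in> borel_measurable (borel \<Otimes>\<^sub>M borel)"
    by (simp add: partial2_def case_prod_beta')
  then have p_meas: "(\<lambda>(s, t). p s t) \<in> borel_measurable (borel \<Otimes>\<^sub>M borel)"
    unfolding p_def by (simp add: case_prod_beta')
  have c_meas: "(\<lambda>(s, t). c s t) \<in> borel_measurable (borel \<Otimes>\<^sub>M borel)"
    using c by (simp add: is_cond_c_def)
  \<comment> \<open>Where \<open>dl\<close> is not differentiable, \<open>p\<close> is arbitrary; this affects only a null set of \<open>t\<close>.\<close>
  have p_deriv: "AE t in lborel. (phi s has_real_derivative p s t) (at t)" for s
  proof -
    have "AE u in lborel. (\<lambda>u. dl s u x xs) differentiable (at u)"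
      using b_lip by (intro AE_differentiable_locally_lipschitz) auto
    then have "AE t in lborel. (\<lambda>u. dl s u x xs) differentiable (at (s * cos \<theta> + t * sin \<theta>))"
      by (rule AE_lborel_affine) (use sin in simp)
    then show ?thesis
    proof eventually_elim
      case (elim t)
      then have "((\<lambda>u. dl s u x xs) has_real_derivative partial2 dl s (s * cos \<theta> + t * sin \<theta>) x xs) (at (s * cos \<theta> + t * sin \<theta>))"
        by (auto simp: real_differentiable_def partial2_def dest: DERIV_imp_deriv)
      then show ?case unfolding phi_def p_def
        by (rule DERIV_chain2) (auto intro!: derivative_eq_intros)
    qed
  qed
  define J where "J = (\<lambda>s. \<integral>t. partial2 dl s (s * cos \<theta> + t * sin \<theta>) x xs * c s t \<partial>lborel)"
  have pc: "p s t * c s t = sin \<theta> * (partial2 dl s (s * cos \<theta> + t * sin \<theta>) x xs * c s t)" for s t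
    by (simp add: p_def)
  interpret conditional_covariance D F "\<lambda>z. x \<bullet> z" "\<lambda>z. v \<bullet> z" phi p c
  proof
    show "subalgebra D F" by (rule sub)
    show "(\<lambda>z. x \<bullet> z) \<in> borel_measurable F" by (rule S_F)
    show "integrable D (\<lambda>z. v \<bullet> z)" by (rule v_ex)
    show "locally_lipschitz (phi s)" for s
      unfolding phi_def using b_lip by (intro locally_lipschitz_affine) auto
    show "AE z in D. c (x \<bullet> z) t = real_cond_exp D F (\<lambda>z. (v \<bullet> z - real_cond_exp D F (\<lambda>z. v \<bullet> z) z) * of_bool (t \<le> v \<bullet> z)) z" for t
      using c unfolding is_cond_c_def cep by blast
    let ?f = "\<lambda>s. \<integral>\<^sup>+t. ennreal \<bar>partial2 dl s (s * cos \<theta> + t * sin \<theta>) x xs * c s t\<bar> \<partial>lborel"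
    have fm: "(\<lambda>(s, t). ennreal \<bar>partial2 dl s (s * cos \<theta> + t * sin \<theta>) x xs * c s t\<bar>) \<in> borel_measurable (borel \<Otimes>\<^sub>M lborel)"
      using p2_meas c_meas by (simp add: case_prod_beta')
    then have "?f \<in> borel_measurable borel" by (rule lborel.borel_measurable_nn_integral)
    then have "(\<integral>\<^sup>+s. ?f s \<partial>law_proj D x) = (\<integral>\<^sup>+z. ?f (x \<bullet> z) \<partial>D)"
      by (subst nn_integral_distr) auto
    moreover have "(\<integral>\<^sup>+t. ennreal \<bar>p s t * c s t\<bar> \<partial>lborel) = ennreal (sin \<theta>) * ?f s" for s
    proof -
      have "(\<lambda>t. ennreal \<bar>partial2 dl s (s * cos \<theta> + t * sin \<theta>) x xs * c s t\<bar>) \<in> borel_measurable lborel"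
        using measurable_compose[OF _ fm, of "\<lambda>t. (s, t)" lborel] by simp
      then show ?thesis
        using sin unfolding pc by (subst nn_integral_cmult[symmetric]) (auto simp: abs_mult ennreal_mult)
    qed
    ultimately show "(\<integral>\<^sup>+z. (\<integral>\<^sup>+t. ennreal \<bar>p (x \<bullet> z) t * c (x \<bullet> z) t\<bar> \<partial>lborel) \<partial>D) < \<infinity>"
      using b_fin \<open>?f \<in> borel_measurable borel\<close>
      by (simp add: nn_integral_cmult ennreal_mult_less_top)
  qed (fact phi_meas p_meas c_meas p_deriv)+
  have phi_eq: "phi (x \<bullet> z) (v \<bullet> z) = dl (x \<bullet> z) (xs \<bullet> z) x xs" for z
    by (simp add: phi_def xsz)
  have g_inner: "grad_integrand dl x xs z \<bullet> xs = sin \<theta> * (dl (x \<bullet> z) (xs \<bullet> z) x xs * (v \<bullet> z))" for z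
    unfolding grad_integrand_def inner_scaleR_left perp_inner
    by (simp add: inner_commute[of z xs] xsz cos)
  have g_int: "integrable D (grad_integrand dl x xs)" using g_ex x by blast
  have "integrable D (\<lambda>z. sin \<theta> * (dl (x \<bullet> z) (xs \<bullet> z) x xs * (v \<bullet> z)))"
    using integrable_inner_left[of xs D "grad_integrand dl x xs"] g_int by (simp add: g_inner)
  then have hV: "integrable D (\<lambda>z. dl (x \<bullet> z) (xs \<bullet> z) x xs * (v \<bullet> z))"
    using sin by simp
  have "g_loss D dl x xs \<bullet> xs = (\<integral>z. grad_integrand dl x xs z \<bullet> xs \<partial>D)"
    unfolding g_loss_def using g_int by (subst integral_inner_left) auto
  also have "\<dots> = sin \<theta> * (\<integral>z. dl (x \<bullet> z) (xs \<bullet> z) x xs * (v \<bullet> z) \<partial>D)"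
    by (simp add: g_inner)
  finally have g_eq: "g_loss D dl x xs \<bullet> xs = sin \<theta> * (\<integral>z. dl (x \<bullet> z) (xs \<bullet> z) x xs * (v \<bullet> z) \<partial>D)" .
  have J_meas: "J \<in> borel_measurable borel"
    unfolding J_def using p2_meas c_meas
    by (intro lborel.borel_measurable_lebesgue_integral) (simp add: case_prod_beta')
  have "(\<integral>z. (\<integral>t. p (x \<bullet> z) t * c (x \<bullet> z) t \<partial>lborel) \<partial>D) = sin \<theta> * (\<integral>z. J (x \<bullet> z) \<partial>D)"
    unfolding pc J_def by simp
  also have "(\<integral>z. J (x \<bullet> z) \<partial>D) = (\<integral>s. J s \<partial>law_proj D x)"
    using J_meas by (subst integral_distr) auto
  also have "sin \<theta> * \<dots> \<le> sin \<theta> * (- \<mu>2)"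
    using b sin unfolding J_def by (intro mult_left_mono) auto
  finally have "(\<integral>z. (\<integral>t. p (x \<bullet> z) t * c (x \<bullet> z) t \<partial>lborel) \<partial>D) \<le> sin \<theta> * (- \<mu>2)" .
  moreover have "(\<integral>z. dl (x \<bullet> z) (xs \<bullet> z) x xs * (v \<bullet> z) \<partial>D) =
     (\<integral>z. cond_exp_proj D x (\<lambda>w. dl (x \<bullet> w) (xs \<bullet> w) x xs) z * cond_exp_proj D x (\<lambda>w. v \<bullet> w) z \<partial>D)
      + (\<integral>z. (\<integral>t. p (x \<bullet> z) t * c (x \<bullet> z) t \<partial>lborel) \<partial>D)"
    using integral_phi_V dl_ex hV a_ex unfolding phi_eq cep by blast
  ultimately have "(\<integral>z. dl (x \<bullet> z) (xs \<bullet> z) x xs * (v \<bullet> z) \<partial>D) \<le> - (\<mu>1 + \<mu>2 * sin \<theta>)"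
    using a by (simp add: algebra_simps)
  then have "g_loss D dl x xs \<bullet> xs \<le> sin \<theta> * - (\<mu>1 + \<mu>2 * sin \<theta>)"
    unfolding g_eq using sin by (intro mult_left_mono) auto
  then have main: "g_loss D dl x xs \<bullet> xs \<le> - (sin \<theta> * (\<mu>1 + \<mu>2 * sin \<theta>))"
    by (simp only: mult_minus_right)
  have pos: "\<mu>1 + \<mu>2 * sin \<theta> \<ge> 0" using mu sin by simp
  have "(norm (x - xs))\<^sup>2 = 2 - 2 * cos \<theta>"
    unfolding power2_norm_eq_inner
    by (simp add: inner_diff_left inner_diff_right xx cos inner_commute[of xs x])
  also have "\<dots> \<le> (2 * sin \<theta>)\<^sup>2"
  proof -
    have "0 < cos \<theta>" using \<theta> by (intro cos_gt_zero) auto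
    then have "0 \<le> (1 - cos \<theta>) * (2 + 4 * cos \<theta>)" by simp
    \<comment> \<open>The difference of the two sides is \<open>(1 - cos \<theta>) (2 + 4 cos \<theta>)\<close>.\<close>
    then show ?thesis by (simp add: power_mult_distrib sin_squared_eq) (simp add: algebra_simps power2_eq_square)
  qed
  finally have dist: "norm (x - xs) \<le> 2 * sin \<theta>"
    by (rule power2_le_imp_le) (use sin in simp)
  show ?thesis
  proof (intro conjI allI impI)
    fix L1 :: real
    assume L1: "0 < L1" "\<forall>y\<in>sphere 0 1. norm (g_loss D dl y xs) \<le> L1"
    then have "norm (g_loss D dl x xs) / L1 \<le> 1" using x by (simp add: divide_le_eq)
    then have "sin \<theta> * (\<mu>1 + \<mu>2 * sin \<theta>) * (norm (g_loss D dl x xs) / L1) \<le> sin \<theta> * (\<mu>1 + \<mu>2 * sin \<theta>) * 1"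
      using pos sin by (intro mult_left_mono) auto
    moreover have "- ((\<mu>1 + \<mu>2 * sin \<theta>) / L1) * sin \<theta> * norm (g_loss D dl x xs)
        = - (sin \<theta> * (\<mu>1 + \<mu>2 * sin \<theta>) * (norm (g_loss D dl x xs) / L1))"
      by simp
    ultimately show "g_loss D dl x xs \<bullet> xs
              \<le> - ((\<mu>1 + \<mu>2 * sin \<theta>) / L1) * sin \<theta> * norm (g_loss D dl x xs)"
      using main by linarith
  next
    fix L2 :: real
    assume L2: "0 < L2" "\<forall>y\<in>sphere 0 1. norm (g_loss D dl y xs) \<le> L2 * norm (y - xs)"
    then have "norm (g_loss D dl x xs) \<le> L2 * norm (x - xs)" using x by blast
    also have "\<dots> \<le> L2 * (2 * sin \<theta>)" using L2(1) dist by (intro mult_left_mono) auto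
    finally have "norm (g_loss D dl x xs) / (2 * L2) \<le> sin \<theta>" using L2(1) by (simp add: divide_le_eq mult_ac)
    then have "(\<mu>1 + \<mu>2 * sin \<theta>) * (norm (g_loss D dl x xs) / (2 * L2)) \<le> (\<mu>1 + \<mu>2 * sin \<theta>) * sin \<theta>"
      using pos by (intro mult_left_mono) auto
    moreover have "- ((\<mu>1 + \<mu>2 * sin \<theta>) / (2 * L2)) * norm (g_loss D dl x xs)
        = - ((\<mu>1 + \<mu>2 * sin \<theta>) * (norm (g_loss D dl x xs) / (2 * L2)))"
      by simp
    moreover have "sin \<theta> * (\<mu>1 + \<mu>2 * sin \<theta>) = (\<mu>1 + \<mu>2 * sin \<theta>) * sin \<theta>"
      by (rule mult.commute)
    ultimately show "g_loss D dl x xs \<bullet> xs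
              \<le> - ((\<mu>1 + \<mu>2 * sin \<theta>) / (2 * L2)) * norm (g_loss D dl x xs)"
      using main by linarith
  qed
qed

end
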